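(* Let $G$ be a connected circle graph on $n$ vertices. Then the partial Petrial polynomial $P_G^{\times}(z)$ is binomial if and only if $G$ is a path.
   Context: All graphs are finite. A path on $n\ge 1$ vertices is the simple graph with vertices $v_1,\dots,v_n$ and edges $v_iv_{i+1}$ for $1\le i\le n-1$ (a single vertex is a path). A ribbon graph $R$ is a (orientable or non-orientable) surface with boundary, represented as the union of two sets of topological discs, a set $V(R)$ of vertices and a set $E(R)$ of edges, such that: (1) the vertices and edges intersect in disjoint line segments; (2) each such line segment lies on the boundary of precisely one vertex and precisely one edge; (3) every edge contains exactly two such line segments. For a ribbon graph $R$, let $v(R)$, $e(R)$, $c(R)$, $f(R)$ be the numbers of vertices, edges, connected components and boundary components of $R$. The Euler characteristic is $\chi(R)=v(R)-e(R)+f(R)$, and the Euler genus is $\varepsilon(R)=2c(R)-\chi(R)$. For $A\subseteq E(R)$, the partial Petrial $R^{\times|A}$ is the ribbon graph obtained from $R$ by adding a half-twist to each edge in $A$ (that is, for each edge in $A$, detach one end from its incident vertex disc, give the edge a half-twist, and reattach the end). The partial Petrial polynomial of $R$ is ${}^{\partial}\varepsilon^{\times}_{R}(z):=\sum_{A\subseteq E(R)}z^{\varepsilon(R^{\times|A})}$. A bouquet is a ribbon graph with exactly one vertex; all of its edges are loops. Two loops of a bouquet are interlaced if their ends are met in an alternating order when travelling round the boundary of the vertex. The intersection graph $I(B)$ of a bouquet $B$ is the simple graph with vertex set $E(B)$ in which two vertices $e_1,e_2$ are adjacent if and only if $e_1$ and $e_2$ are interlaced in $B$. A graph is a circle graph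 if it is (isomorphic to) the intersection graph of a bouquet. The partial Petrial polynomial of a circle graph $G$ is $P_G^{\times}(z):={}^{\partial}\varepsilon^{\times}_{B}(z)$, where $B$ is any bouquet whose intersection graph is isomorphic to $G$; it is known that this does not depend on the choice of $B$. A polynomial is binomial if it contains exactly two non-zero terms, i.e. it is of the form $az^k+bz^m$ with $k\ne m$ and $a,b\neq 0$. *)

theory Defs
  imports
    "HOL-Computational_Algebra.Polynomial"
    "Graph_Theory.Pair_Digraph"
    "Graph_Theory.Digraph_Isomorphism"
begin

section \<open>Ribbon graphs\<close>

text \<open>
  A ribbon graph is encoded up to homeomorphism by the endpoints, called corners, of the line
  segments in which its vertex discs meet its edge discs.  The segments are disjoint, so a corner
  lies on exactly one of them.  At every corner exactly three curves of the surface start, and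
  each of them leads to another corner:
    \<^item> \<open>seg\<close>: the line segment itself;
    \<^item> \<open>side\<close>: the free boundary arc of the edge disc, that is, one of the two arcs left over from
      its boundary circle when its two segments are removed;
    \<^item> \<open>arc\<close>: the free boundary arc of the vertex disc, between two consecutive segments.
  These are the three fixed-point-free involutions of a graph-encoded map (usually called
  \<open>\<tau>\<^sub>2\<close>, \<open>\<tau>\<^sub>0\<close>, \<open>\<tau>\<^sub>1\<close>).  A vertex disc that meets no edge has no corners, so the number of these
  isolated vertices is recorded separately.
\<close>

record 'c ribbon =
  corners :: "'c set"
  seg :: "'c \<Rightarrow> 'c"
  side :: "'c \<Rightarrow> 'c"
  arc :: "'c \<Rightarrow> 'c"
  isolated :: nat

definition fpf_involution_on :: "'c set \<Rightarrow> ('c \<Rightarrow> 'c) \<Rightarrow> bool" where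
  "fpf_involution_on S g \<longleftrightarrow> (\<forall>x\<in>S. g x \<in> S \<and> g (g x) = x \<and> g x \<noteq> x)"

text \<open>
  The last two conditions say that every edge disc has exactly two segments: its boundary circle
  passes through four distinct corners \<open>x\<close>, \<open>seg x\<close>, \<open>side (seg x)\<close>, \<open>seg (side (seg x)) = side x\<close>.
\<close>

definition ribbon_graph :: "'c ribbon \<Rightarrow> bool" where
  "ribbon_graph R \<longleftrightarrow> finite (corners R)
     \<and> fpf_involution_on (corners R) (seg R)
     \<and> fpf_involution_on (corners R) (side R)
     \<and> fpf_involution_on (corners R) (arc R)
     \<and> (\<forall>x\<in>corners R. side R (seg R x) = seg R (side R x))
     \<and> (\<forall>x\<in>corners R. side R x \<noteq> seg R x)"

text \<open>
  Orbits on \<open>S\<close> of the group generated by a set \<open>F\<close> of involutions of \<open>S\<close>; as the generators are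
  self-inverse, following them forwards already gives a symmetric relation.
\<close>

definition orbits :: "'c set \<Rightarrow> ('c \<Rightarrow> 'c) set \<Rightarrow> 'c set set" where
  "orbits S F = S // {(x, y). x \<in> S \<and> (x, y) \<in> {(u, g u) |u g. u \<in> S \<and> g \<in> F}\<^sup>*}"

text \<open>An edge disc is identified with the set of its four corners.\<close>

definition edges :: "'c ribbon \<Rightarrow> 'c set set" where
  "edges R = orbits (corners R) {seg R, side R}"

definition num_edges :: "'c ribbon \<Rightarrow> nat" where
  "num_edges R = card (edges R)"

definition num_vertices :: "'c ribbon \<Rightarrow> nat" where
  "num_vertices R = card (orbits (corners R) {seg R, arc R}) + isolated R"

definition num_components :: "'c ribbon \<Rightarrow> nat" where
  "num_components R = card (orbits (corners R) {seg R, side R, arc R}) + isolated R"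

text \<open>The boundary of the surface is the union of the free arcs of the edge and vertex discs.\<close>

definition num_boundary :: "'c ribbon \<Rightarrow> nat" where
  "num_boundary R = card (orbits (corners R) {side R, arc R}) + isolated R"

definition euler_char :: "'c ribbon \<Rightarrow> int" where
  "euler_char R = int (num_vertices R) - int (num_edges R) + int (num_boundary R)"

definition euler_genus :: "'c ribbon \<Rightarrow> int" where
  "euler_genus R = 2 * int (num_components R) - euler_char R"


section \<open>Partial Petrials\<close>

text \<open>
  Let \<open>{x, seg x}\<close> be the segment at one end of an edge and \<open>{side x, side (seg x)}\<close> the one at
  the other end.  Detaching one end and reattaching it after a half-twist exchanges the two
  endpoints of that segment, so that the free arc starting at \<open>x\<close> now ends at \<open>side (seg x)\<close>.
\<close>

definition partial_petrial :: "'c ribbon \<Rightarrow> 'c set set \<Rightarrow> 'c ribbon" where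
  "partial_petrial R A =
     R\<lparr>side := (\<lambda>x. if x \<in> \<Union>A then side R (seg R x) else side R x)\<rparr>"

lemma ribbon_graph_partial_petrial:
  assumes "ribbon_graph R" and "A \<subseteq> edges R"
  shows "ribbon_graph (partial_petrial R A)"
proof -
  let ?r = "{(u, g u) |u g. u \<in> corners R \<and> g \<in> {seg R, side R}}"
  have "seg R x \<in> e \<and> side R x \<in> e" if e: "e \<in> edges R" "x \<in> e" "x \<in> corners R" for e x
  proof -
    obtain y where y: "y \<in> corners R" "e = {(x, y). x \<in> corners R \<and> (x, y) \<in> ?r\<^sup>*} `` {y}"
      using e(1) unfolding edges_def orbits_def by (blast elim: quotientE)
    have yx: "(y, x) \<in> ?r\<^sup>*"
      using e(2) y by auto
    have "(x, seg R x) \<in> ?r" "(x, side R x) \<in> ?r"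
      using e(3) by blast+
    then have "(y, seg R x) \<in> ?r\<^sup>*" "(y, side R x) \<in> ?r\<^sup>*"
      using yx by (meson rtrancl.rtrancl_into_rtrancl)+
    then show ?thesis
      using y by auto
  qed
  then have step: "seg R x \<in> \<Union>A \<and> side R x \<in> \<Union>A" if "x \<in> \<Union>A" "x \<in> corners R" for x
    using that assms(2) by blast
  have inv: "seg R x \<in> corners R" "seg R (seg R x) = x" "seg R x \<noteq> x"
    "side R x \<in> corners R" "side R (side R x) = x" "side R x \<noteq> x"
    "arc R x \<in> corners R" "arc R (arc R x) = x" "arc R x \<noteq> x"
    "side R (seg R x) = seg R (side R x)" "side R x \<noteq> seg R x" if "x \<in> corners R" for x
    using assms(1) that by (auto simp: ribbon_graph_def fpf_involution_on_def)
  have iff: "seg R x \<in> \<Union>A \<longleftrightarrow> x \<in> \<Union>A" "side R x \<in> \<Union>A \<longleftrightarrow> x \<in> \<Union>A" if "x \<in> corners R" for x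
    using step that inv by metis+
  have neq: "seg R (side R x) \<noteq> x" "seg R (side R x) \<noteq> seg R x" if "x \<in> corners R" for x
    using inv that by metis+
  show ?thesis
    using assms(1) unfolding ribbon_graph_def fpf_involution_on_def partial_petrial_def
    by (auto simp del: Union_iff simp: inv iff neq)
qed

text \<open>
  The Euler genus of a ribbon graph is non-negative, so \<open>nat\<close> loses nothing.
\<close>

definition partial_petrial_poly :: "'c ribbon \<Rightarrow> int poly" where
  "partial_petrial_poly R =
     (\<Sum>A\<in>Pow (edges R). monom 1 (nat (euler_genus (partial_petrial R A))))"


section \<open>Bouquets and circle graphs\<close>

definition bouquet :: "'c ribbon \<Rightarrow> bool" where
  "bouquet B \<longleftrightarrow> ribbon_graph B \<and> num_vertices B = 1"

text \<open>
  Travelling round the vertex of a bouquet alternates between crossing a segment and following a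
  free arc.  Started at a corner \<open>x\<close>, this enters the segments at the corners \<open>travel B x i\<close>.  There
  are \<open>card (corners B) div 2\<close> segments, and each is entered once in one round.
\<close>

definition travel :: "'c ribbon \<Rightarrow> 'c \<Rightarrow> nat \<Rightarrow> 'c" where
  "travel B x i = ((arc B \<circ> seg B) ^^ i) x"

definition interlaced :: "'c ribbon \<Rightarrow> 'c set \<Rightarrow> 'c set \<Rightarrow> bool" where
  "interlaced B e1 e2 \<longleftrightarrow>
     (\<exists>x\<in>corners B. \<exists>i j k. 0 < i \<and> i < j \<and> j < k \<and> k < card (corners B) div 2 \<and>
        x \<in> e1 \<and> travel B x i \<in> e2 \<and> travel B x j \<in> e1 \<and> travel B x k \<in> e2)"

text \<open>
  Finite simple graphs are the symmetric loop-free digraphs \<^term>\<open>pair_graph\<close>.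
\<close>

definition intersection_graph :: "'c ribbon \<Rightarrow> 'c set pair_pre_digraph" where
  "intersection_graph B =
     \<lparr>pverts = edges B, parcs = {(e1, e2). e1 \<in> edges B \<and> e2 \<in> edges B \<and> interlaced B e1 e2}\<rparr>"

abbreviation graph_iso :: "'a pair_pre_digraph \<Rightarrow> 'b pair_pre_digraph \<Rightarrow> bool" where
  "graph_iso G H \<equiv> digraph_iso (with_proj G) (with_proj H)"

lemma graph_iso_iff:
  assumes "pair_wf_digraph G"
  shows "graph_iso G H \<longleftrightarrow>
    (\<exists>f. inj_on f (pverts G) \<and> pverts H = f ` pverts G \<and> parcs H = map_prod f f ` parcs G)"
    (is "_ \<longleftrightarrow> ?R")
proof
  assume "graph_iso G H"
  then obtain h where h: "pre_digraph.digraph_isomorphism (with_proj G) h"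
    and H: "with_proj H = app_iso h (with_proj G)"
    by (auto simp: digraph_iso_def)
  have "fst = iso_tail h" "snd = iso_head h"
    using H by (auto simp: with_proj_def app_iso_def)
  then have "iso_arcs h a = map_prod (iso_verts h) (iso_verts h) a" if "a \<in> parcs G" for a
    using h that
    by (cases a, cases "iso_arcs h a") (auto simp: pre_digraph.digraph_isomorphism_def)
  then have "parcs H = map_prod (iso_verts h) (iso_verts h) ` parcs G"
    "pverts H = iso_verts h ` pverts G" "inj_on (iso_verts h) (pverts G)"
    using H h by (auto simp: with_proj_def app_iso_def pre_digraph.digraph_isomorphism_def)
  then show ?R
    by blast
next
  assume ?R
  then obtain f where f: "inj_on f (pverts G)" "pverts H = f ` pverts G"
    "parcs H = map_prod f f ` parcs G"
    by blast
  interpret pair_wf_digraph G by (fact assms)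
  have "inj_on (map_prod f f) (parcs G)"
    by (rule inj_on_subset[OF map_prod_inj_on[OF f(1) f(1)]]) (auto dest: in_arcsD1 in_arcsD2)
  then show "graph_iso G H"
    using f wf_digraph_wp_iff[of G] assms
    by (auto simp: digraph_iso_def pre_digraph.digraph_isomorphism_def app_iso_def with_proj_def
        intro!: exI[of _ "\<lparr>iso_verts = f, iso_arcs = map_prod f f, iso_head = snd, iso_tail = fst\<rparr>"])
qed

text \<open>
  Ribbon graphs are finite, so every bouquet has a copy whose corners are natural numbers.
\<close>

definition represents :: "nat ribbon \<Rightarrow> 'a pair_pre_digraph \<Rightarrow> bool" where
  "represents B G \<longleftrightarrow> bouquet B \<and> graph_iso (intersection_graph B) G"

definition circle_graph :: "'a pair_pre_digraph \<Rightarrow> bool" where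
  "circle_graph G \<longleftrightarrow> pair_graph G \<and> (\<exists>B. represents B G)"

text \<open>
  The polynomial depends only on the intersection graph, so any representing bouquet may be taken.
\<close>

definition circle_graph_poly :: "'a pair_pre_digraph \<Rightarrow> int poly" where
  "circle_graph_poly G = partial_petrial_poly (SOME B. represents B G)"


section \<open>Paths and binomials\<close>

definition path_graph :: "nat \<Rightarrow> nat pair_pre_digraph" where
  "path_graph n =
     \<lparr>pverts = {1..n}, parcs = {(i, j). i \<in> {1..n} \<and> j \<in> {1..n} \<and> (j = i + 1 \<or> i = j + 1)}\<rparr>"

definition is_path :: "'a pair_pre_digraph \<Rightarrow> bool" where
  "is_path G \<longleftrightarrow> (\<exists>n\<ge>1. graph_iso (path_graph n) G)"

definition binomial_poly :: "'a::comm_monoid_add poly \<Rightarrow> bool" where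
  "binomial_poly p \<longleftrightarrow> (\<exists>a b k m. k \<noteq> m \<and> a \<noteq> 0 \<and> b \<noteq> 0 \<and> p = monom a k + monom b m)"

end

theory Submission
  imports Defs
begin

text \<open>
  Colour the boundary components of a bouquet with two colours and record the loops across whose
  ends the colour changes.  The recorded sets are exactly the kernel vectors over GF(2) of the
  matrix \<open>M\<close> with the adjacency matrix of the intersection graph off the diagonal and ones at the
  twisted loops on it.  So the number of boundary components is one more than the corank of \<open>M\<close>,
  the Euler genus is its rank, and the partial Petrial polynomial lists the ranks of \<open>M\<close> over all
  choices of the diagonal.

  Flipping a diagonal entry in the support of a kernel vector lowers the corank by one, so all
  coranks from 0 up to the maximum occur, and with all vertices as a kernel vector the maximum is at
  least 1.  The polynomial is therefore binomial iff no diagonal has corank 2.  For a path the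
  corank is at most 1, since kernel vectors are determined by their value at an end vertex.  For
  the converse, a diagonal entry 1 at \<open>v\<close> is pivoted away: this passes to the local complement at
  \<open>v\<close> without \<open>v\<close>, which by induction is a path for every \<open>v\<close>.  Looking at a vertex of degree at
  most 2 then shows that the graph itself is a path.
\<close>

section \<open>Intersection matrices over GF(2)\<close>

text \<open>No rank is ever formed: corank \<open>c\<close> appears as a kernel with
  \<open>2 ^ c\<close> elements, so lowering the corank by one is halving, and corank at least 2
  means at least four kernel vectors. The link to topology equates \<open>2 ^ num_boundary B\<close>
  with twice the kernel size; the factor 2 is the free choice of the colour at one corner. The
  recorded set satisfies the row of a loop for the following reason. Walk round the vertex from one
  end of the loop to the other. The colour changes at every end of a recorded loop; loops with both
  ends on this stretch cancel mod 2, and exactly the interlaced ones remain. Crossing the loop's own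
  first end gives one more change if the loop itself is recorded. The free sides of the loop must
  join equal colours, and a half-twist decides at which endpoint of the second segment that
  comparison takes place: this is the diagonal entry.\<close>

text \<open>
  Kernel over GF(2), vectors being subsets of \<open>V\<close>, of the adjacency matrix with the indicator of
  \<open>D\<close> added to its diagonal.
\<close>

definition kernel :: "'v set \<Rightarrow> ('v \<Rightarrow> 'v \<Rightarrow> bool) \<Rightarrow> 'v set \<Rightarrow> 'v set set" where
  "kernel V adj D = {X. X \<subseteq> V \<and> (\<forall>v\<in>V. odd (card {u\<in>X. adj v u}) \<longleftrightarrow> v \<in> X \<and> v \<in> D)}"

lemma finite_kernel: "finite V \<Longrightarrow> finite (kernel V adj D)"
  by (rule finite_subset[of _ "Pow V"]) (auto simp: kernel_def)

lemma empty_in_kernel: "{} \<in> kernel V adj D"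
  by (simp add: kernel_def)

lemma odd_card_sym_diff:
  assumes "finite A" "finite B"
  shows "odd (card (sym_diff A B)) \<longleftrightarrow> odd (card A) \<noteq> odd (card B)"
proof -
  have "card A = card (A - B) + card (A \<inter> B)" "card B = card (B - A) + card (A \<inter> B)"
    using assms by (metis card_Int_Diff Int_commute add.commute)+
  moreover have "card (sym_diff A B) = card (A - B) + card (B - A)"
    using assms by (intro card_Un_disjoint) auto
  ultimately show ?thesis by auto
qed

lemma kernel_sym_diff:
  assumes "finite V" "X \<in> kernel V adj D" "Y \<in> kernel V adj D"
  shows "sym_diff X Y \<in> kernel V adj D"
proof -
  have fin: "finite X" "finite Y"
    using assms by (auto simp: kernel_def dest: finite_subset)
  have "odd (card {u \<in> sym_diff X Y. adj v u}) \<longleftrightarrow>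
      odd (card {u\<in>X. adj v u}) \<noteq> odd (card {u\<in>Y. adj v u})" for v
  proof -
    have "{u \<in> sym_diff X Y. adj v u} = sym_diff {u\<in>X. adj v u} {u\<in>Y. adj v u}"
      by blast
    then show ?thesis
      using fin odd_card_sym_diff[of "{u\<in>X. adj v u}" "{u\<in>Y. adj v u}"] by simp
  qed
  then show ?thesis
    using assms(2,3) unfolding kernel_def by blast
qed

text \<open>Evaluates the bilinear form of the adjacency matrix mod 2: the kernel equation for
  \<open>Y\<close> leaves an odd row only at the vertices of \<open>Y\<close> in
  \<open>D\<close>.\<close>

lemma odd_sum_card_adj:
  assumes "finite X" "X \<subseteq> V" "Y \<in> kernel V adj D"
  shows "odd (\<Sum>x\<in>X. card {y\<in>Y. adj x y}) \<longleftrightarrow> odd (card (X \<inter> Y \<inter> D))"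
proof -
  have "{x\<in>X. odd (card {y\<in>Y. adj x y})} = X \<inter> Y \<inter> D"
    using assms by (auto simp: kernel_def)
  then show ?thesis
    using even_sum_iff[OF assms(1), of "\<lambda>x. card {y\<in>Y. adj x y}"] by simp
qed

text \<open>
  Flipping the diagonal entry at a vertex \<open>v\<close> of a kernel vector \<open>X\<close> leaves exactly the kernel
  vectors \<open>Y\<close> that vanish at \<open>v\<close>: otherwise the two evaluations of \<open>X\<^sup>T M Y\<close> differ.
\<close>

lemma kernel_flip:
  assumes "finite V" "symp adj" "X \<in> kernel V adj D" "v \<in> X"
  shows "kernel V adj (sym_diff D {v}) = {Y \<in> kernel V adj D. v \<notin> Y}"
proof -
  let ?D' = "sym_diff D {v}"
  have "v \<notin> Y" if Y: "Y \<in> kernel V adj ?D'" for Y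
  proof
    assume "v \<in> Y"
    have fin: "finite X" "finite Y" "X \<subseteq> V" "Y \<subseteq> V"
      using assms(1,3) Y by (auto simp: kernel_def dest: finite_subset)
    have "(\<Sum>x\<in>X. card {y\<in>Y. adj x y}) = (\<Sum>y\<in>Y. card {x\<in>X. adj x y})"
      using fin by (intro sum_multicount_gen) auto
    also have "\<dots> = (\<Sum>y\<in>Y. card {x\<in>X. adj y x})"
      using assms(2) by (intro sum.cong refl arg_cong[where f = card]) (auto dest: sympD)
    finally have "odd (card (X \<inter> Y \<inter> ?D')) \<longleftrightarrow> odd (card (Y \<inter> X \<inter> D))"
      using odd_sum_card_adj[OF fin(1,3) Y] odd_sum_card_adj[OF fin(2,4) assms(3)] by metis
    moreover have "X \<inter> Y \<inter> ?D' = sym_diff (Y \<inter> X \<inter> D) {v}"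
      using \<open>v \<in> X\<close> \<open>v \<in> Y\<close> by blast
    ultimately show False
      using odd_card_sym_diff[of "Y \<inter> X \<inter> D" "{v}"] fin by simp
  qed
  moreover have "Y \<in> kernel V adj ?D' \<longleftrightarrow> Y \<in> kernel V adj D" if "v \<notin> Y" for Y
    using that by (auto simp: kernel_def)
  ultimately show ?thesis
    by blast
qed

text \<open>Adding a kernel vector that contains \<open>v\<close> swaps the kernel vectors with
  \<open>v\<close> and those without, so each kind is half of them; flipping the diagonal at
  \<open>v\<close> keeps the second kind.\<close>

lemma kernel_halve:
  assumes "finite V" "symp adj" "D \<subseteq> V" "2 \<le> card (kernel V adj D)"
  shows "\<exists>D'\<subseteq>V. card (kernel V adj D) = 2 * card (kernel V adj D')"
proof -
  have "kernel V adj D \<noteq> {{}}"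
  proof
    assume "kernel V adj D = {{}}"
    with assms(4) show False by simp
  qed
  then obtain X v where X: "X \<in> kernel V adj D" "v \<in> X"
    using empty_in_kernel[of V adj D] by blast
  let ?K = "kernel V adj D"
  have "bij_betw (sym_diff X) {Y\<in>?K. v \<notin> Y} {Y\<in>?K. v \<in> Y}"
    using X kernel_sym_diff[OF assms(1) X(1)]
    by (intro bij_betw_byWitness[where f' = "sym_diff X"]) auto
  then have "card {Y\<in>?K. v \<notin> Y} = card {Y\<in>?K. v \<in> Y}"
    by (rule bij_betw_same_card)
  moreover have "card ?K = card {Y\<in>?K. v \<in> Y} + card {Y\<in>?K. v \<notin> Y}"
    using finite_kernel[OF assms(1)]
    by (subst card_Un_disjoint[symmetric]) (auto intro: arg_cong[where f = card])
  moreover have "sym_diff D {v} \<subseteq> V"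
    using assms(3) X by (auto simp: kernel_def)
  ultimately show ?thesis
    using kernel_flip[OF assms(1,2) X] by (intro exI[of _ "sym_diff D {v}"]) simp
qed

lemma card_kernel_ge_2:
  assumes "finite V" "V \<noteq> {}"
  shows "\<exists>D\<subseteq>V. 2 \<le> card (kernel V adj D)"
proof -
  \<comment> \<open>Degree parities on the diagonal make every row sum even, so the all-ones vector
    lies in the kernel.\<close>
  let ?D = "{v\<in>V. odd (card {u\<in>V. adj v u})}"
  have "{{}, V} \<subseteq> kernel V adj ?D"
    by (auto simp: kernel_def)
  then have "card {{}, V} \<le> card (kernel V adj ?D)"
    by (intro card_mono finite_kernel assms)
  then show ?thesis
    using assms(2) by (intro exI[of _ ?D]) auto
qed

text \<open>Stated for a set and a predicate because the induction changes both, deleting a vertex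
  and complementing locally.\<close>

definition path_like :: "'v set \<Rightarrow> ('v \<Rightarrow> 'v \<Rightarrow> bool) \<Rightarrow> bool" where
  "path_like V adj \<longleftrightarrow> (\<exists>\<phi>. bij_betw \<phi> V {..<card V} \<and>
     (\<forall>x\<in>V. \<forall>y\<in>V. adj x y \<longleftrightarrow> \<phi> x = Suc (\<phi> y) \<or> \<phi> y = Suc (\<phi> x)))"

lemma path_likeE:
  assumes "path_like V adj"
  obtains \<phi> where "inj_on \<phi> V" "\<forall>i<card V. \<exists>x\<in>V. \<phi> x = i" "\<forall>x\<in>V. \<phi> x < card V"
    "\<forall>x\<in>V. \<forall>y\<in>V. adj x y \<longleftrightarrow> \<phi> x = Suc (\<phi> y) \<or> \<phi> y = Suc (\<phi> x)"
proof -
  obtain \<phi> where \<phi>: "inj_on \<phi> V" "\<phi> ` V = {..<card V}"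
    and adj: "\<forall>x\<in>V. \<forall>y\<in>V. adj x y \<longleftrightarrow> \<phi> x = Suc (\<phi> y) \<or> \<phi> y = Suc (\<phi> x)"
    using assms unfolding path_like_def bij_betw_def by blast
  have "\<forall>i<card V. \<exists>x\<in>V. \<phi> x = i"
    using \<phi>(2) by (metis imageE lessThan_iff)
  moreover have "\<forall>x\<in>V. \<phi> x < card V"
    using \<phi>(2) by blast
  ultimately show ?thesis
    using that[of \<phi>] \<phi>(1) adj by blast
qed

lemma path_likeI:
  assumes "finite V" "inj_on \<phi> V" "\<And>x. x \<in> V \<Longrightarrow> \<phi> x < card V"
    "\<And>x y. x \<in> V \<Longrightarrow> y \<in> V \<Longrightarrow> adj x y \<longleftrightarrow> \<phi> x = Suc (\<phi> y) \<or> \<phi> y = Suc (\<phi> x)"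
  shows "path_like V adj"
proof -
  have "\<phi> ` V = {..<card V}"
    using assms by (intro card_subset_eq) (auto simp: card_image)
  then show ?thesis
    using assms(2,4) unfolding path_like_def bij_betw_def by blast
qed

text \<open>The row of the vertex at position \<open>k\<close> fixes the entry at
  \<open>k + 1\<close> from the earlier ones, so the entry at position 0 fixes the whole kernel
  vector.\<close>

lemma card_kernel_path_like:
  assumes "finite V" "path_like V adj"
  shows "card (kernel V adj D) \<le> 2"
proof -
  obtain \<phi> where \<phi>: "inj_on \<phi> V" "\<forall>i<card V. \<exists>x\<in>V. \<phi> x = i" "\<forall>x\<in>V. \<phi> x < card V"
    "\<forall>x\<in>V. \<forall>y\<in>V. adj x y \<longleftrightarrow> \<phi> x = Suc (\<phi> y) \<or> \<phi> y = Suc (\<phi> x)"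
    using assms(2) by (rule path_likeE)
  have zero: "v \<notin> X"
    if X: "X \<in> kernel V adj D" "\<And>v. v \<in> V \<Longrightarrow> \<phi> v = 0 \<Longrightarrow> v \<notin> X" and v: "v \<in> V" for X v
    using v
  proof (induction "\<phi> v" arbitrary: v rule: less_induct)
    case less
    show ?case
    proof (cases "\<phi> v")
      case 0
      then show ?thesis using X(2) less.prems by blast
    next
      case (Suc k)
      then obtain u where u: "u \<in> V" "\<phi> u = k"
        using \<phi>(2,3) less.prems by (metis Suc_lessD)
      show ?thesis
      proof
        assume "v \<in> X"
        \<comment> \<open>Any other neighbour of \<open>u\<close> has a smaller position and is
          absent from \<open>X\<close> by induction, so \<open>v\<close> alone makes the row of
          \<open>u\<close> odd and forces \<open>u\<close> into \<open>X\<close>.\<close>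
        have "{w\<in>X. adj u w} = {v}"
        proof (intro equalityI subsetI)
          fix w assume w: "w \<in> {w\<in>X. adj u w}"
          then have "w \<in> V" using X(1) by (auto simp: kernel_def)
          then have "\<not> \<phi> w < \<phi> v" using less.hyps w by blast
          then have "\<phi> w = \<phi> v"
            using \<phi>(4)[rule_format, OF u(1) \<open>w \<in> V\<close>] w u(2) Suc by auto
          then show "w \<in> {v}"
            using \<phi>(1) \<open>w \<in> V\<close> less.prems by (auto dest: inj_onD)
        next
          fix w assume "w \<in> {v}"
          then show "w \<in> {w\<in>X. adj u w}"
            using \<open>v \<in> X\<close> \<phi>(4)[rule_format, OF u(1) less.prems] u(2) Suc by auto
        qed
        then have "u \<in> X"
          using X(1) u(1) by (auto simp: kernel_def)
        then show False
          using less.hyps[of u] u Suc by auto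
      qed
    qed
  qed
  show ?thesis
  proof (cases "V = {}")
    case True
    then have "kernel V adj D \<subseteq> {{}}" by (auto simp: kernel_def)
    then have "card (kernel V adj D) \<le> card {{}::'a set}" by (intro card_mono) auto
    then show ?thesis by simp
  next
    case False
    then have "card V > 0" using assms(1) by (simp add: card_gt_0_iff)
    then obtain v where v: "v \<in> V" "\<phi> v = 0" using \<phi>(2) by blast
    have "inj_on (\<lambda>X. v \<in> X) (kernel V adj D)"
    proof (rule inj_onI)
      fix X Y assume XY: "X \<in> kernel V adj D" "Y \<in> kernel V adj D" "(v \<in> X) = (v \<in> Y)"
      have "sym_diff X Y \<in> kernel V adj D"
        using kernel_sym_diff[OF assms(1)] XY by blast
      moreover have "w \<notin> sym_diff X Y" if "w \<in> V" "\<phi> w = 0" for w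
        using that v \<phi>(1) XY(3) by (metis Diff_iff UnE inj_onD)
      ultimately have "\<forall>w\<in>V. w \<notin> sym_diff X Y"
        using zero by blast
      then show "X = Y"
        using XY(1,2) by (auto simp: kernel_def)
    qed
    then have "card (kernel V adj D) \<le> card (UNIV :: bool set)"
      by (rule card_inj_on_le) auto
    then show ?thesis by simp
  qed
qed

section \<open>Graphs with small kernels are paths\<close>

text \<open>The clause \<open>x \<noteq> y\<close> introduces no loops; the diagonal part of the
  pivot is absorbed in the choice of the diagonal set.\<close>

definition local_compl :: "('v \<Rightarrow> 'v \<Rightarrow> bool) \<Rightarrow> 'v \<Rightarrow> 'v \<Rightarrow> 'v \<Rightarrow> bool" where
  "local_compl adj v x y \<longleftrightarrow> adj x y \<noteq> (adj v x \<and> adj v y \<and> x \<noteq> y)"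

lemma symp_local_compl: "symp adj \<Longrightarrow> symp (local_compl adj v)"
  by (auto simp: local_compl_def symp_def)

lemma irreflp_local_compl: "irreflp adj \<Longrightarrow> irreflp (local_compl adj v)"
  by (auto simp: local_compl_def irreflp_def)

text \<open>
  Local complementation at \<open>v\<close> followed by deleting \<open>v\<close> is the Schur complement of a diagonal
  entry 1 at \<open>v\<close>, so it does not change the corank.
\<close>

lemma card_kernel_local_compl:
  assumes "finite V" "v \<in> V" "symp adj" "irreflp adj" "D' \<subseteq> V - {v}"
  shows "\<exists>D\<subseteq>V. card (kernel (V - {v}) (local_compl adj v) D') \<le> card (kernel V adj D)"
proof -
  define N where "N = {u\<in>V. adj v u}"
  \<comment> \<open>Undoes the pivot: the entry at \<open>v\<close> is 1, and the pivot changed the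
    diagonal exactly at the neighbours of \<open>v\<close>.\<close>
  define D where "D = insert v (sym_diff D' N)"
  \<comment> \<open>With entry 1 at \<open>v\<close>, the row of \<open>v\<close> prescribes the
    value at \<open>v\<close> as the parity of its neighbours in \<open>X\<close>.\<close>
  define ext where "ext = (\<lambda>X. if odd (card {u\<in>X. adj v u}) then insert v X else X)"
  have vN: "v \<notin> N" using assms(4) by (auto simp: N_def irreflp_def)
  have ker: "ext X \<in> kernel V adj D" if X: "X \<in> kernel (V - {v}) (local_compl adj v) D'" for X
  proof -
    have XV: "X \<subseteq> V - {v}" and fin: "finite X" and
      Xk: "\<And>w. w \<in> V - {v} \<Longrightarrow> odd (card {u\<in>X. local_compl adj v w u}) \<longleftrightarrow> w \<in> X \<and> w \<in> D'"
      using X assms(1) by (auto simp: kernel_def dest: finite_subset)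
    have "odd (card {u\<in>ext X. adj w u}) \<longleftrightarrow> w \<in> ext X \<and> w \<in> D" if w: "w \<in> V" for w
    proof (cases "w = v")
      case True
      have "{u\<in>ext X. adj v u} = {u\<in>X. adj v u}"
        using assms(4) by (auto simp: ext_def irreflp_def)
      then show ?thesis
        using True XV by (auto simp: ext_def D_def)
    next
      case False
      show ?thesis
      proof (cases "adj v w")
        case False
        have "{u\<in>ext X. adj w u} = {u\<in>X. local_compl adj v w u}"
          using False assms(3) by (auto simp: ext_def local_compl_def dest: sympD)
        moreover have "w \<in> ext X \<and> w \<in> D \<longleftrightarrow> w \<in> X \<and> w \<in> D'"
          using \<open>w \<noteq> v\<close> False by (auto simp: ext_def D_def N_def)
        ultimately show ?thesis
          using Xk[of w] w \<open>w \<noteq> v\<close> by simp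
      next
        case True
        then have "adj w v" using assms(3) by (auto dest: sympD)
        \<comment> \<open>The local complement adds row \<open>v\<close> to row \<open>w\<close>,
          except at \<open>w\<close> itself. The exception contributes \<open>w \<in> X\<close>,
          which the flipped diagonal entry at \<open>w\<close> compensates.\<close>
        let ?S = "{u\<in>X. adj v u} - {w}"
        have lc: "{u\<in>X. local_compl adj v w u} = sym_diff {u\<in>X. adj w u} ?S"
          using True assms(4) by (auto simp: local_compl_def irreflp_def)
        have 1: "odd (card {u\<in>X. local_compl adj v w u}) \<longleftrightarrow>
            odd (card {u\<in>X. adj w u}) \<noteq> odd (card ?S)"
          unfolding lc using fin by (intro odd_card_sym_diff) auto
        have 2: "odd (card ?S) \<longleftrightarrow> odd (card {u\<in>X. adj v u}) \<noteq> (w \<in> X)"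
        proof (cases "w \<in> X")
          case True
          have "card {u\<in>X. adj v u} = Suc (card ?S)"
            using True \<open>adj v w\<close> fin by (intro card.remove) auto
          then show ?thesis using True by simp
        next
          case False
          then have "?S = {u\<in>X. adj v u}" by auto
          then show ?thesis using False by simp
        qed
        have "v \<notin> X" using XV by auto
        then have 3: "odd (card {u\<in>ext X. adj w u}) \<longleftrightarrow>
            odd (card {u\<in>X. adj w u}) \<noteq> odd (card {u\<in>X. adj v u})"
        proof (cases "odd (card {u\<in>X. adj v u})")
          case True
          then have "{u\<in>ext X. adj w u} = insert v {u\<in>X. adj w u}"
            using \<open>adj w v\<close> by (auto simp: ext_def)
          then show ?thesis using True \<open>v \<notin> X\<close> fin by simp
        qed (simp add: ext_def)
        have 4: "w \<in> ext X \<and> w \<in> D \<longleftrightarrow> w \<in> X \<and> w \<notin> D'"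
          using \<open>w \<noteq> v\<close> True w by (auto simp: ext_def D_def N_def)
        show ?thesis
          using 1 2 3 4 Xk[of w] w \<open>w \<noteq> v\<close> by blast
      qed
    qed
    moreover have "ext X \<subseteq> V"
      using XV assms(2) by (auto simp: ext_def)
    ultimately show ?thesis by (simp add: kernel_def)
  qed
  have "inj_on ext (kernel (V - {v}) (local_compl adj v) D')"
  proof (rule inj_on_inverseI)
    fix X assume "X \<in> kernel (V - {v}) (local_compl adj v) D'"
    then show "ext X - {v} = X" by (auto simp: ext_def kernel_def)
  qed
  then have "card (kernel (V - {v}) (local_compl adj v) D') \<le> card (kernel V adj D)"
    using ker finite_kernel[OF assms(1)] by (intro card_inj_on_le[of ext]) auto
  moreover have "D \<subseteq> V" using assms(2,5) by (auto simp: D_def N_def)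
  ultimately show ?thesis by blast
qed

section \<open>Local structure of paths, and putting a vertex back into a path\<close>

lemma path_like_no_triangle:
  assumes "path_like V adj" "x \<in> V" "y \<in> V" "z \<in> V" "adj x y" "adj y z" "adj x z"
  shows False
  using assms(1)
proof (rule path_likeE)
  fix \<phi> assume "\<forall>x\<in>V. \<forall>y\<in>V. adj x y \<longleftrightarrow> \<phi> x = Suc (\<phi> y) \<or> \<phi> y = Suc (\<phi> x)"
  then have "\<phi> x = Suc (\<phi> y) \<or> \<phi> y = Suc (\<phi> x)" "\<phi> y = Suc (\<phi> z) \<or> \<phi> z = Suc (\<phi> y)"
    "\<phi> x = Suc (\<phi> z) \<or> \<phi> z = Suc (\<phi> x)"
    using assms(2-) by blast+
  then show False by arith
qed

lemma path_like_card_neighbours: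
  assumes "path_like V adj" "v \<in> V"
  shows "card {u\<in>V. adj v u} \<le> 2"
  using assms(1)
proof (rule path_likeE)
  fix \<phi> assume \<phi>: "inj_on \<phi> V"
    "\<forall>x\<in>V. \<forall>y\<in>V. adj x y \<longleftrightarrow> \<phi> x = Suc (\<phi> y) \<or> \<phi> y = Suc (\<phi> x)"
  have "card {u\<in>V. adj v u} \<le> card {\<phi> v - 1, Suc (\<phi> v)}"
    using \<phi> assms(2) by (intro card_inj_on_le[of \<phi>]) (auto intro: inj_on_subset)
  also have "\<dots> \<le> 2" by (simp add: card_insert_if)
  finally show ?thesis .
qed

lemma path_like_no_isolated:
  assumes "path_like V adj" "v \<in> V" "card V \<ge> 2"
  shows "\<exists>u\<in>V. adj v u"
  using assms(1)
proof (rule path_likeE)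
  fix \<phi> assume \<phi>: "\<forall>i<card V. \<exists>x\<in>V. \<phi> x = i" "\<forall>x\<in>V. \<phi> x < card V"
    "\<forall>x\<in>V. \<forall>y\<in>V. adj x y \<longleftrightarrow> \<phi> x = Suc (\<phi> y) \<or> \<phi> y = Suc (\<phi> x)"
  show ?thesis
  proof (cases "\<phi> v")
    case 0
    then obtain u where "u \<in> V" "\<phi> u = 1" using \<phi>(1) assms(3) by (metis Suc_1 Suc_le_lessD)
    then show ?thesis using \<phi>(3) 0 assms(2) by auto
  next
    case (Suc k)
    then obtain u where "u \<in> V" "\<phi> u = k" using \<phi>(1,2) assms(2) by (metis Suc_lessD)
    then show ?thesis using \<phi>(3) Suc assms(2) by auto
  qed
qed

text \<open>Degree at most 1 puts \<open>a\<close> at an end of the remaining path, so the leaf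
  \<open>v\<close> can be numbered before its first or after its last position.\<close>

lemma path_like_insert_end:
  assumes "finite V" "v \<in> V" "symp adj" "irreflp adj" "path_like (V - {v}) adj'"
    "a \<in> V" "{u\<in>V. adj v u} = {a}" "card {u\<in>V - {v}. adj' a u} \<le> 1"
    "\<And>x y. x \<in> V - {v} \<Longrightarrow> y \<in> V - {v} \<Longrightarrow> adj x y \<longleftrightarrow> adj' x y"
  shows "path_like V adj"
  using assms(5)
proof (rule path_likeE)
  define m where "m = card (V - {v})"
  fix \<phi> assume \<phi>': "inj_on \<phi> (V - {v})" "\<forall>i<card (V - {v}). \<exists>x\<in>V - {v}. \<phi> x = i"
    "\<forall>x\<in>V - {v}. \<phi> x < card (V - {v})"
    "\<forall>x\<in>V - {v}. \<forall>y\<in>V - {v}. adj' x y \<longleftrightarrow> \<phi> x = Suc (\<phi> y) \<or> \<phi> y = Suc (\<phi> x)"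
  note \<phi> = \<phi>'[folded m_def]
  have m: "card V = Suc m" using card.remove[OF assms(1,2)] by (simp add: m_def)
  have va: "adj v x \<longleftrightarrow> x = a" "adj x v \<longleftrightarrow> x = a" if "x \<in> V" for x
    using assms(3,7) that by (auto dest: sympD)
  have a: "a \<in> V - {v}" using assms(4,7) by (auto simp: irreflp_def)
  have \<phi>a: "\<phi> x = \<phi> a \<longleftrightarrow> x = a" if "x \<in> V - {v}" for x
    using \<phi>(1) a that by (auto dest: inj_onD)
  have vv: "\<not> adj v v" using assms(4) by (auto simp: irreflp_def)
  have "\<phi> a = 0 \<or> Suc (\<phi> a) = m"
  proof (rule ccontr)
    assume not: "\<not> ?thesis"
    then obtain k where k: "\<phi> a = Suc k" by (cases "\<phi> a") auto
    have "Suc (\<phi> a) < m" using not \<phi>(3) a by (metis Suc_lessI)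
    then obtain c d where "c \<in> V - {v}" "d \<in> V - {v}" "\<phi> c = Suc (\<phi> a)" "\<phi> d = k"
      using \<phi>(2) k by (metis Suc_lessD)
    moreover from this have "adj' a c" "adj' a d" "c \<noteq> d"
      using \<phi>(4) a k by auto
    ultimately show False
      using assms(1,8) by (auto simp: card_le_Suc0_iff_eq)
  qed
  then show ?thesis
  proof
    assume 0: "\<phi> a = 0"
    show ?thesis
    proof (rule path_likeI[OF assms(1), where \<phi> = "\<lambda>u. if u = v then 0 else Suc (\<phi> u)"])
      show "inj_on (\<lambda>u. if u = v then 0 else Suc (\<phi> u)) V"
        using \<phi>(1) by (auto simp: inj_on_def)
      show "(if x = v then 0 else Suc (\<phi> x)) < card V" if "x \<in> V" for x
        using \<phi>(3) m that by auto
      show "adj x y \<longleftrightarrow> (if x = v then 0 else Suc (\<phi> x)) = Suc (if y = v then 0 else Suc (\<phi> y))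
          \<or> (if y = v then 0 else Suc (\<phi> y)) = Suc (if x = v then 0 else Suc (\<phi> x))"
        if "x \<in> V" "y \<in> V" for x y
        using that va[of x] va[of y] \<phi>a[of x] \<phi>a[of y] 0 vv \<phi>(4) assms(9)[of x y] by auto
    qed
  next
    assume e: "Suc (\<phi> a) = m"
    show ?thesis
    proof (rule path_likeI[OF assms(1), where \<phi> = "\<lambda>u. if u = v then m else \<phi> u"])
      show "inj_on (\<lambda>u. if u = v then m else \<phi> u) V"
        using \<phi>(1,3) by (fastforce simp: inj_on_def)
      show "(if x = v then m else \<phi> x) < card V" if "x \<in> V" for x
        using \<phi>(3) m that by (auto simp: less_Suc_eq)
      show "adj x y \<longleftrightarrow> (if x = v then m else \<phi> x) = Suc (if y = v then m else \<phi> y)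
          \<or> (if y = v then m else \<phi> y) = Suc (if x = v then m else \<phi> x)"
        if xy: "x \<in> V" "y \<in> V" for x y
      proof -
        have "\<phi> x < m" if "x \<noteq> v" using \<phi>(3) xy that by auto
        moreover have "\<phi> y < m" if "y \<noteq> v" using \<phi>(3) xy that by auto
        moreover have "adj x y \<longleftrightarrow> \<phi> x = Suc (\<phi> y) \<or> \<phi> y = Suc (\<phi> x)" if "x \<noteq> v" "y \<noteq> v"
          using \<phi>(4) assms(9) that xy by auto
        ultimately show ?thesis
          using xy va[of x] va[of y] \<phi>a[of x] \<phi>a[of y] vv e[symmetric]
          by (cases "x = v"; cases "y = v") auto
      qed
    qed
  qed
qed

text \<open>Here \<open>v\<close> subdivides the edge between \<open>a\<close> and \<open>b\<close>:
  local complementation at \<open>v\<close> joins its two neighbours, and restoring \<open>v\<close>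
  removes that edge.\<close>

lemma path_like_insert_middle:
  assumes "finite V" "v \<in> V" "symp adj" "irreflp adj" "path_like (V - {v}) adj'"
    "a \<in> V" "b \<in> V" "a \<noteq> b" "adj' a b" "\<not> adj a b" "{u\<in>V. adj v u} = {a, b}"
    "\<And>x y. x \<in> V - {v} \<Longrightarrow> y \<in> V - {v} \<Longrightarrow> {x, y} \<noteq> {a, b} \<Longrightarrow> adj x y \<longleftrightarrow> adj' x y"
  shows "path_like V adj"
  using assms(5)
proof (rule path_likeE)
  let ?m = "card (V - {v})"
  fix \<phi> assume \<phi>: "inj_on \<phi> (V - {v})" "\<forall>x\<in>V - {v}. \<phi> x < ?m"
    "\<forall>x\<in>V - {v}. \<forall>y\<in>V - {v}. adj' x y \<longleftrightarrow> \<phi> x = Suc (\<phi> y) \<or> \<phi> y = Suc (\<phi> x)"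
  have m: "card V = Suc ?m" using card.remove[OF assms(1,2)] .
  have vv: "\<not> adj v v" using assms(4) by (auto simp: irreflp_def)
  then have ab: "a \<in> V - {v}" "b \<in> V - {v}" using assms(11) by auto
  \<comment> \<open>Names the ends of the edge in path order, as either of \<open>a\<close> and
    \<open>b\<close> may come first.\<close>
  have main: ?thesis
    if p: "p \<in> V - {v}" "q \<in> V - {v}" "{p, q} = {a, b}" "\<phi> q = Suc (\<phi> p)" for p q
  proof -
    have va: "adj v x \<longleftrightarrow> x = p \<or> x = q" "adj x v \<longleftrightarrow> x = p \<or> x = q" if "x \<in> V" for x
      using assms(3,11) that p(3) by (auto dest: sympD)
    have npq: "\<not> adj p q" "\<not> adj q p"
      using assms(3,10) p(3) by (auto simp: doubleton_eq_iff dest: sympD)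
    have \<phi>p: "\<phi> x = \<phi> p \<longleftrightarrow> x = p" "\<phi> x = Suc (\<phi> p) \<longleftrightarrow> x = q" if "x \<in> V - {v}" for x
      using inj_on_eq_iff[OF \<phi>(1) that] p(1,2,4) by metis+
    \<comment> \<open>The position right behind \<open>p\<close> goes to \<open>v\<close>;
      everything from \<open>q\<close> on moves up by one.\<close>
    define \<psi> where "\<psi> u = (if u = v then Suc (\<phi> p) else if \<phi> u \<le> \<phi> p then \<phi> u else Suc (\<phi> u))" for u
    show ?thesis
    proof (rule path_likeI[OF assms(1), where \<phi> = \<psi>])
      show "inj_on \<psi> V"
      proof (rule inj_onI)
        fix x y assume xy: "x \<in> V" "y \<in> V" "\<psi> x = \<psi> y"
        have "(x = v) = (y = v)"
          using xy(3) by (auto simp: \<psi>_def split: if_splits)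
        moreover have "\<phi> x = \<phi> y" if "x \<noteq> v" "y \<noteq> v"
          using xy(3) that by (simp add: \<psi>_def split: if_splits)
        ultimately show "x = y"
          using xy(1,2) inj_onD[OF \<phi>(1)] by blast
      qed
      show "\<psi> x < card V" if "x \<in> V" for x
      proof (cases "x = v")
        case True
        then show ?thesis using \<phi>(2) m p(1) by (auto simp: \<psi>_def)
      next
        case False
        then have "\<phi> x < card (V - {v})" using \<phi>(2) that by auto
        then show ?thesis unfolding m using False by (simp add: \<psi>_def del: card_Diff_insert)
      qed
      show "adj x y \<longleftrightarrow> \<psi> x = Suc (\<psi> y) \<or> \<psi> y = Suc (\<psi> x)" if xy: "x \<in> V" "y \<in> V" for x y
      proof (cases "x = v \<or> y = v")
        case True
        have \<psi>v: "\<psi> v = Suc (\<phi> p)" by (simp add: \<psi>_def)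
        have \<psi>z: "\<psi> z = \<phi> p \<longleftrightarrow> z = p" "\<psi> z = Suc (Suc (\<phi> p)) \<longleftrightarrow> z = q" if "z \<in> V - {v}" for z
          using \<phi>p[OF that] that by (auto simp: \<psi>_def)
        consider "x = v" "y = v" | "x = v" "y \<in> V - {v}" | "y = v" "x \<in> V - {v}"
          using True xy by blast
        then show ?thesis
        proof cases
          case 1
          then show ?thesis using vv by simp
        next
          case 2
          then show ?thesis using va(1)[OF xy(2)] \<psi>z[of y] \<psi>v by auto
        next
          case 3
          then show ?thesis using va(2)[OF xy(1)] \<psi>z[of x] \<psi>v by auto
        qed
      next
        case False
        show ?thesis
        proof (cases "{x, y} = {a, b}")
          case True
          then have "x = p \<and> y = q \<or> x = q \<and> y = p" using p(3) by (auto simp: doubleton_eq_iff)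
          then show ?thesis using npq p by (auto simp: \<psi>_def)
        next
          case neq: False
          then have "adj x y \<longleftrightarrow> \<phi> x = Suc (\<phi> y) \<or> \<phi> y = Suc (\<phi> x)"
            using \<phi>(3) assms(12)[of x y] False xy by auto
          moreover have "\<not> (x = p \<and> y = q)" "\<not> (x = q \<and> y = p)"
            using neq p(3) by auto
          moreover have "\<phi> x = \<phi> p \<longleftrightarrow> x = p" "\<phi> x = Suc (\<phi> p) \<longleftrightarrow> x = q"
            "\<phi> y = \<phi> p \<longleftrightarrow> y = p" "\<phi> y = Suc (\<phi> p) \<longleftrightarrow> y = q"
            using False xy by (simp_all add: \<phi>p)
          moreover have "\<psi> x = (if \<phi> x \<le> \<phi> p then \<phi> x else Suc (\<phi> x))"
            "\<psi> y = (if \<phi> y \<le> \<phi> p then \<phi> y else Suc (\<phi> y))"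
            using False by (simp_all add: \<psi>_def)
          ultimately show ?thesis
            by (smt (verit) Suc_inject le_Suc_eq not_less_eq_eq)
        qed
      qed
    qed
  qed
  have "\<phi> a = Suc (\<phi> b) \<or> \<phi> b = Suc (\<phi> a)" using \<phi>(3) ab assms(9) by blast
  then show ?thesis
    using main[of a b] main[of b a] ab by auto
qed

text \<open>Fewer than four kernel vectors means corank at most 1, which each local complement with
  its vertex removed inherits. Most unwanted configurations are excluded by a triangle, an isolated
  vertex or a vertex of degree above 2 in one of these smaller paths.\<close>

theorem path_like_if_small_kernels:
  assumes "finite V" "V \<noteq> {}" "symp adj" "irreflp adj"
    "\<And>D. D \<subseteq> V \<Longrightarrow> card (kernel V adj D) < 4"
  shows "path_like V adj"
  using assms
proof (induction "card V" arbitrary: V adj rule: less_induct)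
  case less
  note fin = \<open>finite V\<close> and sym = \<open>symp adj\<close> and irr = \<open>irreflp adj\<close>
  have symD: "adj x y \<Longrightarrow> adj y x" for x y using sym by (auto dest: sympD)
  have irrD: "\<not> adj x x" for x using irr by (auto simp: irreflp_def)
  show ?case
  proof (cases "card V \<le> 1")
    case True
    show ?thesis
    proof (rule path_likeI[of V "\<lambda>_. 0"])
      show "inj_on (\<lambda>_. 0::nat) V"
        using True fin by (auto simp: inj_on_def card_le_Suc0_iff_eq)
      show "0 < card V" using fin \<open>V \<noteq> {}\<close> by (simp add: card_gt_0_iff)
      show "adj x y \<longleftrightarrow> (0::nat) = Suc 0 \<or> (0::nat) = Suc 0" if "x \<in> V" "y \<in> V" for x y
        using that True fin irrD by (auto simp: card_le_Suc0_iff_eq)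
    qed (use fin in auto)
  next
    case False
    then have two: "card V \<ge> 2" by simp
    have lc: "path_like (V - {v}) (local_compl adj v)" if v: "v \<in> V" for v
    proof (rule less.hyps)
      show "card (V - {v}) < card V" using card.remove[OF fin v] by simp
      show "V - {v} \<noteq> {}" using two card.remove[OF fin v] by fastforce
      show "card (kernel (V - {v}) (local_compl adj v) D) < 4" if "D \<subseteq> V - {v}" for D
        using card_kernel_local_compl[OF fin v sym irr that] less.prems(5) by (meson le_less_trans)
    qed (use fin symp_local_compl[OF sym] irreflp_local_compl[OF irr] in auto)
    have no_iso: "\<exists>u\<in>V. adj v u" if v: "v \<in> V" for v
    proof (rule ccontr)
      assume iso: "\<not> (\<exists>u\<in>V. adj v u)"
      \<comment> \<open>Degree parities put \<open>V\<close> in the kernel; the row and column of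
        the isolated \<open>v\<close> are zero, so \<open>{v}\<close> lies there too, and the two
        span four vectors.\<close>
      let ?D = "{w\<in>V. odd (card {u\<in>V. adj w u})}"
      have "{v} \<in> kernel V adj ?D"
      proof -
        have e: "\<not> odd (card {u\<in>{v}. adj w u})" if "w \<in> V" for w
        proof -
          have "{u\<in>{v}. adj w u} = {}" using iso that symD by auto
          then show ?thesis by (simp only: card.empty) simp
        qed
        have "v \<notin> ?D"
        proof -
          have "{u\<in>V. adj v u} = {}" using iso by auto
          then show ?thesis by (simp only: mem_Collect_eq card.empty) simp
        qed
        then have "odd (card {u\<in>{v}. adj w u}) \<longleftrightarrow> w \<in> {v} \<and> w \<in> ?D" if "w \<in> V" for w
          using e[OF that] by blast
        then show ?thesis using v unfolding kernel_def by blast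
      qed
      moreover have "V \<in> kernel V adj ?D"
        by (auto simp: kernel_def)
      ultimately have "{{}, {v}, V, sym_diff V {v}} \<subseteq> kernel V adj ?D"
        using kernel_sym_diff[OF fin] empty_in_kernel by blast
      then have "card {{}, {v}, V, sym_diff V {v}} \<le> card (kernel V adj ?D)"
        using finite_kernel[OF fin] by (intro card_mono)
      moreover have "V - {v} \<noteq> {}" using two card.remove[OF fin v] by fastforce
      then obtain u where "u \<in> V" "u \<noteq> v" by blast
      then have "card {{}, {v}, V, sym_diff V {v}} = 4"
        using v by (subst card_insert_disjoint; auto)+
      ultimately show False
        using less.prems(5)[of ?D] by auto
    qed
    \<comment> \<open>Adjacent twins: local complementation at \<open>a\<close> cancels every edge
      from \<open>b\<close> to a third vertex, so \<open>b\<close> would be isolated in a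
      path.\<close>
    have twins: False if ab: "a \<in> V" "b \<in> V" "adj a b" "card V \<ge> 3"
      "\<And>w. w \<in> V \<Longrightarrow> w \<noteq> a \<Longrightarrow> w \<noteq> b \<Longrightarrow> adj a w \<longleftrightarrow> adj b w" for a b
    proof -
      have "card (V - {a}) \<ge> 2" "b \<in> V - {a}"
        using ab fin irrD by auto
      then obtain w where "w \<in> V - {a}" "local_compl adj a b w"
        using path_like_no_isolated[OF lc[OF ab(1)]] by blast
      then show False
        using ab irrD by (auto simp: local_compl_def)
    qed
    have triangle: False if "w \<in> V" "{x, y, z} \<subseteq> V - {w}" "local_compl adj w x y"
      "local_compl adj w y z" "local_compl adj w x z" for w x y z
      using path_like_no_triangle[OF lc[OF that(1)]] that by blast
    \<comment> \<open>A non-neighbour \<open>u\<close> of \<open>v\<close> keeps its neighbourhood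
      in the local complement at \<open>v\<close>, a path with degrees at most 2. So minimum degree
      3 forces a complete graph, in which any two vertices are adjacent twins.\<close>
    have "\<exists>v\<in>V. card {u\<in>V. adj v u} \<le> 2"
    proof (rule ccontr)
      assume "\<not> ?thesis"
      then have deg: "card {u\<in>V. adj v u} \<ge> 3" if "v \<in> V" for v using that by force
      have complete: "adj u v" if uv: "u \<in> V" "v \<in> V" "u \<noteq> v" for u v
      proof (rule ccontr)
        assume "\<not> adj u v"
        then have "{w\<in>V - {v}. local_compl adj v u w} = {w\<in>V. adj u w}"
          using symD by (auto simp: local_compl_def)
        then show False
          using path_like_card_neighbours[OF lc[OF uv(2)], of u] deg[OF uv(1)] uv by auto
      qed
      obtain a where a: "a \<in> V" using \<open>V \<noteq> {}\<close> by auto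
      obtain b where b: "b \<in> V" "adj a b" using no_iso[OF a] by auto
      have "card V \<ge> 3"
        using deg[OF a] card_mono[OF fin, of "{u\<in>V. adj a u}"] by auto
      then show False
        using twins[OF a b] complete a b by blast
    qed
    then obtain v where v: "v \<in> V" "card {u\<in>V. adj v u} \<le> 2" by blast
    have "{u\<in>V. adj v u} \<noteq> {}" using no_iso[OF v(1)] by auto
    then have "card {u\<in>V. adj v u} \<noteq> 0" using fin by simp
    then consider "card {u\<in>V. adj v u} = 1" | "card {u\<in>V. adj v u} = 2"
      using v(2) by linarith
    then show ?thesis
    proof cases
      case 1
      then obtain a where a: "{u\<in>V. adj v u} = {a}" by (auto simp: card_1_singleton_iff)
      then have av: "a \<in> V" "adj v a" "a \<noteq> v" and only: "\<And>u. u \<in> V \<Longrightarrow> adj v u \<Longrightarrow> u = a"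
        using irrD by auto
      have eq: "adj x y \<longleftrightarrow> local_compl adj v x y" if "x \<in> V - {v}" "y \<in> V - {v}" for x y
        using only that irrD by (auto simp: local_compl_def)
      \<comment> \<open>Two further neighbours \<open>c\<close>, \<open>d\<close> of
        \<open>a\<close> are not adjacent, since a path has no triangle; local complementation at
        \<open>a\<close> would then turn \<open>v\<close>, \<open>c\<close>, \<open>d\<close> into
        one.\<close>
      have "card {u\<in>V - {v}. local_compl adj v a u} \<le> 1"
      proof (rule ccontr)
        assume "\<not> ?thesis"
        then obtain c d where cd: "c \<in> V - {v}" "d \<in> V - {v}" "adj a c" "adj a d" "c \<noteq> d"
          using fin eq av by (auto simp: card_le_Suc0_iff_eq)
        have "\<not> adj c d"
          using path_like_no_triangle[OF lc[OF v(1)], of a c d] cd eq av by auto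
        moreover have "\<not> adj v c" "\<not> adj v d" using only[of c] only[of d] cd irrD by blast+
        moreover have "adj a v" using symD[OF av(2)] .
        ultimately have "local_compl adj a v c" "local_compl adj a c d" "local_compl adj a v d"
          using cd unfolding local_compl_def by blast+
        moreover have "{v, c, d} \<subseteq> V - {a}" using cd av v irrD by blast
        ultimately show False using triangle[OF av(1)] by blast
      qed
      then show ?thesis
        using path_like_insert_end[OF fin v(1) sym irr lc[OF v(1)] av(1) a _ eq] by blast
    next
      case 2
      then obtain a b where ab: "{u\<in>V. adj v u} = {a, b}" "a \<noteq> b" by (auto simp: card_2_iff)
      then have av: "a \<in> V" "adj v a" "a \<noteq> v" "b \<in> V" "adj v b" "b \<noteq> v"
        and only: "\<And>u. u \<in> V \<Longrightarrow> adj v u \<Longrightarrow> u = a \<or> u = b"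
        using irrD by auto
      have three: "card V \<ge> 3"
        using card_mono[OF fin, of "{v, a, b}"] av ab v by auto
      show ?thesis
      proof (cases "adj a b")
        case True
        \<comment> \<open>If \<open>w\<close>, other than \<open>v\<close>, missed one of
          \<open>a\<close> and \<open>b\<close>, the triangle \<open>v\<close>, \<open>a\<close>,
          \<open>b\<close> would survive local complementation at \<open>w\<close>. So
          \<open>a\<close> and \<open>b\<close> are adjacent twins.\<close>
        have "adj a w \<longleftrightarrow> adj b w" if w: "w \<in> V" "w \<noteq> a" "w \<noteq> b" for w
        proof (cases "w = v")
          case True
          then show ?thesis using av symD by auto
        next
          case False
          have nw: "\<not> adj w v" using only w symD by blast
          have "adj w a \<and> adj w b"
          proof (rule ccontr)
            assume "\<not> ?thesis"
            then have "local_compl adj w v a" "local_compl adj w a b" "local_compl adj w v b"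
              using nw True av unfolding local_compl_def by blast+
            moreover have "{v, a, b} \<subseteq> V - {w}" using w False av v by blast
            ultimately show False using triangle[OF w(1)] by blast
          qed
          then show ?thesis using symD by blast
        qed
        then show ?thesis
          using twins[OF av(1,4) True three] by blast
      next
        case False
        have "local_compl adj v a b"
          using False av ab by (auto simp: local_compl_def)
        moreover have "adj x y \<longleftrightarrow> local_compl adj v x y"
          if "x \<in> V - {v}" "y \<in> V - {v}" "{x, y} \<noteq> {a, b}" for x y
          using only that irrD by (auto simp: local_compl_def)
        ultimately show ?thesis
          using path_like_insert_middle[OF fin v(1) sym irr lc[OF v(1)] av(1,4) ab(2)] False ab(1)
          by blast
      qed
    qed
  qed
qed

section \<open>Orbits of involutions\<close>

definition involutions_on :: "'c set \<Rightarrow> ('c \<Rightarrow> 'c) set \<Rightarrow> bool" where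
  "involutions_on S F \<longleftrightarrow> (\<forall>g\<in>F. \<forall>x\<in>S. g x \<in> S \<and> g (g x) = x)"

text \<open>Each member is a colour class of a two-colouring that is constant on orbits.\<close>

definition invariant_sets :: "'c set \<Rightarrow> ('c \<Rightarrow> 'c) set \<Rightarrow> 'c set set" where
  "invariant_sets S F = {T. T \<subseteq> S \<and> (\<forall>g\<in>F. \<forall>x\<in>S. g x \<in> T \<longleftrightarrow> x \<in> T)}"

lemma equiv_orbits:
  assumes "involutions_on S F"
  shows "equiv S {(x, y). x \<in> S \<and> (x, y) \<in> {(u, g u) |u g. u \<in> S \<and> g \<in> F}\<^sup>*}" (is "equiv S ?r")
proof -
  let ?R = "{(u, g u) |u g. u \<in> S \<and> g \<in> F}"
  have "sym ?R"
    using assms by (auto simp: sym_def involutions_on_def) metis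
  then have symR: "sym (?R\<^sup>*)" by (rule sym_rtrancl)
  have closed: "y \<in> S" if "(x, y) \<in> ?R\<^sup>*" "x \<in> S" for x y
    using that by (induction rule: rtrancl_induct) (use assms in \<open>auto simp: involutions_on_def\<close>)
  show ?thesis
  proof (rule equivI)
    show "?r \<subseteq> S \<times> S" using closed by blast
    show "refl_on S ?r" by (simp add: refl_on_def)
    show "sym ?r" using closed symD[OF symR] unfolding sym_def by blast
    show "trans ?r" unfolding trans_def using rtrancl_trans[of _ _ ?R] by blast
  qed
qed

text \<open>Invariant sets are the unions of orbits. Counting them instead of orbits makes boundary
  numbers comparable with kernel sizes.\<close>

lemma card_invariant_sets:
  assumes "finite S" "involutions_on S F"
  shows "card (invariant_sets S F) = 2 ^ card (orbits S F)"
proof -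
  let ?R = "{(u, g u) |u g. u \<in> S \<and> g \<in> F}"
  let ?r = "{(x, y). x \<in> S \<and> (x, y) \<in> ?R\<^sup>*}"
  note eq = equiv_orbits[OF assms(2)]
  have orb: "orbits S F = S // ?r" by (simp add: orbits_def)
  have U: "\<Union>(orbits S F) = S" unfolding orb by (rule Union_quotient[OF eq])
  have disj: "P = Q \<or> P \<inter> Q = {}" if "P \<in> orbits S F" "Q \<in> orbits S F" for P Q
    using quotient_disj[OF eq] that unfolding orb by blast
  have ne: "P \<noteq> {}" if "P \<in> orbits S F" for P
    using in_quotient_imp_non_empty[OF eq] that unfolding orb by blast
  have gmem: "g x \<in> P \<longleftrightarrow> x \<in> P" if "P \<in> orbits S F" "g \<in> F" "x \<in> S" for P g x
  proof -
    have "(x, g x) \<in> ?r" using that by blast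
    then show ?thesis
      using in_quotient_imp_closed[OF eq] that(1) eq unfolding orb
      by (metis (no_types, lifting) equivE symD)
  qed
  have "bij_betw Union (Pow (orbits S F)) (invariant_sets S F)"
    unfolding bij_betw_def
  proof
    show "inj_on Union (Pow (orbits S F))"
    proof (rule inj_onI)
      have sub: "\<A> \<subseteq> \<B>" if AB: "\<A> \<subseteq> orbits S F" "\<B> \<subseteq> orbits S F" "\<Union>\<A> = \<Union>\<B>" for \<A> \<B>
      proof
        fix P assume "P \<in> \<A>"
        then obtain x where x: "x \<in> P" using ne[of P] AB(1) by blast
        then obtain Q where "Q \<in> \<B>" "x \<in> Q" using \<open>P \<in> \<A>\<close> AB(3) by blast
        then show "P \<in> \<B>" using disj[of P Q] x \<open>P \<in> \<A>\<close> AB by blast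
      qed
      show "\<A> = \<B>" if "\<A> \<in> Pow (orbits S F)" "\<B> \<in> Pow (orbits S F)" "\<Union>\<A> = \<Union>\<B>" for \<A> \<B>
        using sub[of \<A> \<B>] sub[of \<B> \<A>] that by auto
    qed
    show "Union ` Pow (orbits S F) = invariant_sets S F"
    proof (intro equalityI subsetI)
      fix T assume "T \<in> Union ` Pow (orbits S F)"
      then obtain \<A> where A: "\<A> \<subseteq> orbits S F" "T = \<Union>\<A>" by blast
      then have "T \<subseteq> S" using U by blast
      moreover have "g x \<in> T \<longleftrightarrow> x \<in> T" if "g \<in> F" "x \<in> S" for g x
        using gmem that A by blast
      ultimately show "T \<in> invariant_sets S F"
        by (simp add: invariant_sets_def)
    next
      fix T assume T: "T \<in> invariant_sets S F"
      have "P \<subseteq> T" if P: "P \<in> orbits S F" "x \<in> P" "x \<in> T" for P x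
      proof
        fix y assume "y \<in> P"
        then have "(x, y) \<in> ?r"
          using quotient_eq_iff[OF eq, of P P x y] P unfolding orb by blast
        then have "(x, y) \<in> ?R\<^sup>*" by blast
        then show "y \<in> T"
          using P(3) by (induction rule: rtrancl_induct) (use T in \<open>auto simp: invariant_sets_def\<close>)
      qed
      note sub = this
      have "T = \<Union>{P\<in>orbits S F. P \<subseteq> T}"
      proof (intro equalityI subsetI)
        fix x assume "x \<in> T"
        moreover from this have "x \<in> \<Union>(orbits S F)"
          using T U by (auto simp: invariant_sets_def)
        ultimately show "x \<in> \<Union>{P\<in>orbits S F. P \<subseteq> T}"
          using sub by fast
      qed fast
      then show "T \<in> Union ` Pow (orbits S F)" by (rule image_eqI) fast
    qed
  qed
  then have "card (invariant_sets S F) = card (Pow (orbits S F))"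
    by (metis bij_betw_same_card)
  moreover have "finite (orbits S F)"
    using assms(1) U finite_UnionD by metis
  ultimately show ?thesis by (simp add: card_Pow)
qed

lemma card_orbits_eq_1:
  assumes "finite S" "S \<noteq> {}" "involutions_on S F"
  shows "card (orbits S F) = 1 \<longleftrightarrow> invariant_sets S F \<subseteq> {{}, S}"
proof -
  have sub: "{{}, S} \<subseteq> invariant_sets S F"
    using assms(3) by (auto simp: invariant_sets_def involutions_on_def)
  have fin: "finite (invariant_sets S F)"
    by (rule finite_subset[of _ "Pow S"]) (use assms in \<open>auto simp: invariant_sets_def\<close>)
  have two: "card {{}, S} = 2" using assms(2) by simp
  have "card (orbits S F) = 1 \<longleftrightarrow> card (invariant_sets S F) = 2"
    unfolding card_invariant_sets[OF assms(1,3)]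
    using power_inject_exp[of "2::nat" "card (orbits S F)" 1] by simp
  also have "\<dots> \<longleftrightarrow> invariant_sets S F \<subseteq> {{}, S}"
    using card_subset_eq[OF fin sub] sub two by (metis subset_antisym subset_refl)
  finally show ?thesis .
qed

lemma card_orbits_pos:
  assumes "finite S" "S \<noteq> {}" "involutions_on S F"
  shows "card (orbits S F) \<ge> 1"
proof -
  have "finite (invariant_sets S F)"
    by (rule finite_subset[of _ "Pow S"]) (use assms in \<open>auto simp: invariant_sets_def\<close>)
  moreover have "{{}, S} \<subseteq> invariant_sets S F"
    using assms(3) by (auto simp: invariant_sets_def involutions_on_def)
  ultimately have "card {{}, S} \<le> card (invariant_sets S F)" by (intro card_mono)
  then have "2 \<le> (2::nat) ^ card (orbits S F)"
    using card_invariant_sets[OF assms(1,3)] assms(2) by simp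
  then show ?thesis by (cases "card (orbits S F)") auto
qed

section \<open>The vertex of a bouquet\<close>

text \<open>With a corner present, the one vertex carries all corners and \<open>isolated B\<close>
  is 0; the edgeless bouquet is treated separately.\<close>

locale bouquet_with_edges =
  fixes B :: "'c ribbon"
  assumes bouquet: "bouquet B" and nonempty: "corners B \<noteq> {}"
begin

abbreviation "C \<equiv> corners B"
abbreviation "s \<equiv> seg B"
abbreviation "t \<equiv> side B"
abbreviation "r \<equiv> arc B"
abbreviation "tr \<equiv> travel B"
abbreviation "N \<equiv> card C div 2"

definition edge_of :: "'c \<Rightarrow> 'c set" where
  "edge_of x = {x, s x, t x, s (t x)}"

lemma ribbon: "ribbon_graph B"
  using bouquet by (simp add: bouquet_def)

lemma fin: "finite C"
  using ribbon by (simp add: ribbon_graph_def)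

lemma inv:
  assumes "x \<in> C"
  shows "s x \<in> C" "s (s x) = x" "s x \<noteq> x" "t x \<in> C" "t (t x) = x" "t x \<noteq> x"
    "r x \<in> C" "r (r x) = x" "r x \<noteq> x" "t (s x) = s (t x)" "t x \<noteq> s x"
  using ribbon assms by (auto simp: ribbon_graph_def fpf_involution_on_def)

lemma involutions: "F \<subseteq> {s, t, r} \<Longrightarrow> involutions_on C F"
  using inv by (auto simp: involutions_on_def)

lemma isolated: "isolated B = 0" and one_orbit: "card (orbits C {s, r}) = 1"
  using bouquet card_orbits_pos[OF fin nonempty involutions, of "{s, r}"]
  by (auto simp: bouquet_def num_vertices_def)

text \<open>The vertex of a bouquet is a single orbit, so this serves as induction round its
  boundary.\<close>

lemma closed_eq_corners:
  assumes "T \<subseteq> C" "x \<in> T" "\<And>x. x \<in> T \<Longrightarrow> s x \<in> T" "\<And>x. x \<in> T \<Longrightarrow> r x \<in> T"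
  shows "T = C"
proof -
  have "T \<in> invariant_sets C {s, r}"
    using assms inv(2,8) by (auto simp: invariant_sets_def) metis+
  then show ?thesis
    using card_orbits_eq_1[OF fin nonempty involutions, of "{s, r}"] one_orbit assms(2) by auto
qed

lemma num_components: "num_components B = 1"
proof -
  have "invariant_sets C {s, t, r} \<subseteq> invariant_sets C {s, r}"
    by (auto simp: invariant_sets_def)
  then have "card (orbits C {s, t, r}) = 1"
    using card_orbits_eq_1[OF fin nonempty involutions, of "{s, r}"] one_orbit
      card_orbits_eq_1[OF fin nonempty involutions, of "{s, t, r}"] by auto
  then show ?thesis by (simp add: num_components_def isolated)
qed

lemma euler_genus_eq: "euler_genus B = 1 + int (card (edges B)) - int (num_boundary B)"
  using num_components bouquet
  by (simp add: euler_genus_def euler_char_def num_edges_def bouquet_def)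

lemma card_invariant_side_arc: "card (invariant_sets C {t, r}) = 2 ^ num_boundary B"
  using card_invariant_sets[OF fin involutions, of "{t, r}"] isolated
  by (simp add: num_boundary_def)

text \<open>As \<open>seg\<close> and \<open>side\<close> commute, the four corners in
  \<open>edge_of\<close> exhaust an orbit.\<close>

lemma edges_eq: "edges B = edge_of ` C"
proof -
  let ?R = "{(u, g u) |u g. u \<in> C \<and> g \<in> {s, t}}"
  have "{(x, y). x \<in> C \<and> (x, y) \<in> ?R\<^sup>*} `` {x} = edge_of x" if x: "x \<in> C" for x
  proof (intro equalityI subsetI)
    fix y assume "y \<in> {(x, y). x \<in> C \<and> (x, y) \<in> ?R\<^sup>*} `` {x}"
    then have "(x, y) \<in> ?R\<^sup>*" by blast
    then show "y \<in> edge_of x"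
      by (induction rule: rtrancl_induct) (use x inv in \<open>auto simp: edge_of_def\<close>)
  next
    fix y assume y: "y \<in> edge_of x"
    have "(x, s x) \<in> ?R" "(x, t x) \<in> ?R" "(t x, s (t x)) \<in> ?R" using x inv by blast+
    then have "(x, s x) \<in> ?R\<^sup>*" "(x, t x) \<in> ?R\<^sup>*" "(x, s (t x)) \<in> ?R\<^sup>*"
      by (meson r_into_rtrancl rtrancl_into_rtrancl)+
    then show "y \<in> {(x, y). x \<in> C \<and> (x, y) \<in> ?R\<^sup>*} `` {x}"
      using y x by (auto simp: edge_of_def)
  qed
  then show ?thesis
    by (auto simp: edges_def orbits_def quotient_def)
qed

lemma edge_of_in: "x \<in> edge_of x" by (simp add: edge_of_def)

lemma edge_of_eq: "x \<in> C \<Longrightarrow> y \<in> edge_of x \<Longrightarrow> edge_of y = edge_of x"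
  using inv by (auto simp: edge_of_def)

lemma edge_of_sub: "x \<in> C \<Longrightarrow> edge_of x \<subseteq> C"
  using inv by (auto simp: edge_of_def)

lemma in_edge_iff:
  assumes "e \<in> edges B"
  shows "x \<in> e \<longleftrightarrow> x \<in> C \<and> edge_of x = e"
proof -
  obtain z where "z \<in> C" "e = edge_of z" using assms edges_eq by auto
  then show ?thesis using edge_of_eq[of z x] edge_of_sub[of z] edge_of_in[of x] by auto
qed

lemma edge_of_seg: "x \<in> C \<Longrightarrow> edge_of (s x) = edge_of x"
  and edge_of_side: "x \<in> C \<Longrightarrow> edge_of (t x) = edge_of x"
  using inv by (auto simp: edge_of_def)

section \<open>The walk round the vertex\<close>

lemma travel_0 [simp]: "tr x 0 = x"
  and travel_Suc: "tr x (Suc i) = r (s (tr x i))"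
  and travel_add: "tr x (i + j) = tr (tr x i) j"
  by (simp_all add: travel_def add.commute[of i j] funpow_add)

lemma travel_in: "x \<in> C \<Longrightarrow> tr x i \<in> C"
  by (induction i) (auto simp: travel_Suc inv)

lemma travel_inj: "x \<in> C \<Longrightarrow> y \<in> C \<Longrightarrow> tr x i = tr y i \<Longrightarrow> x = y"
proof (induction i)
  case (Suc i)
  then show ?case using inv travel_in by (metis travel_Suc)
qed simp

text \<open>Conjugation by \<open>seg B\<close> inverts \<open>arc B \<circ> seg B\<close>: travel
  from the other endpoint of a segment runs backwards.\<close>

lemma travel_seg: "x \<in> C \<Longrightarrow> tr (s (tr x i)) i = s x"
proof (induction i)
  case (Suc i)
  have "tr (s (tr x (Suc i))) (Suc i) = tr (r (s (s (r (s (tr x i)))))) i"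
    using travel_add[of "s (tr x (Suc i))" 1 i] by (simp add: travel_Suc)
  also have "r (s (s (r (s (tr x i))))) = s (tr x i)"
    using inv travel_in[OF Suc.prems] by metis
  finally show ?case using Suc by simp
qed simp

text \<open>Moving one step inwards from both sides lowers \<open>k\<close> by 2, until a segment or
  an arc would have a fixed point.\<close>

lemma seg_neq_travel: "x \<in> C \<Longrightarrow> s x \<noteq> tr x k"
proof (induction k arbitrary: x rule: less_induct)
  case (less k)
  consider "k = 0" | "k = 1" | j where "k = Suc (Suc j)"
    by (metis One_nat_def not0_implies_Suc)
  then show ?case
  proof cases
    case 1
    then show ?thesis using inv less.prems by simp
  next
    case 2
    then show ?thesis using inv less.prems by (metis One_nat_def travel_0 travel_Suc)
  next
    case 3
    let ?w = "tr x 1"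
    have w: "?w \<in> C" using travel_in less.prems by blast
    show ?thesis
    proof
      assume "s x = tr x k"
      moreover have "s x = tr (s ?w) 1" using travel_seg[OF less.prems, of 1] by simp
      moreover have "tr x k = tr (tr ?w j) 1"
        using 3 by (simp add: travel_add[symmetric])
      ultimately have "s ?w = tr ?w j"
        using travel_inj[of "s ?w" "tr ?w j" 1] w inv travel_in by metis
      then show False using less.IH[of j ?w] 3 w by simp
    qed
  qed
qed

text \<open>The corners visited in one least period and their partners under \<open>seg\<close> are
  disjoint by \<open>seg_neq_travel\<close> and together closed under all moves round the vertex, so
  each kind is half of the corners and the period is \<open>N\<close>.\<close>

lemma travel_structure:
  assumes x: "x \<in> C"
  shows "tr x N = x \<and> inj_on (tr x) {..<N} \<and> 0 < N \<and> C = tr x ` {..<N} \<union> s ` tr x ` {..<N}"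
proof -
  have "\<not> inj_on (tr x) (UNIV :: nat set)"
  proof
    assume "inj_on (tr x) (UNIV :: nat set)"
    moreover have "finite (range (tr x))"
      by (rule finite_subset[OF _ fin]) (use travel_in[OF x] in auto)
    ultimately show False using finite_imageD infinite_UNIV_nat by blast
  qed
  then obtain i j where "tr x i = tr x j" "i < j"
    unfolding inj_on_def by (metis linorder_neqE_nat)
  then have "tr (tr x (j - i)) i = tr x i"
    by (metis add.commute le_add_diff_inverse less_imp_le travel_add)
  then have ex: "0 < j - i \<and> tr x (j - i) = x"
    using travel_inj[OF travel_in[OF x] x] \<open>i < j\<close> by auto
  define p where "p = (LEAST p. 0 < p \<and> tr x p = x)"
  have p: "0 < p" "tr x p = x"
    using LeastI[of "\<lambda>p. 0 < p \<and> tr x p = x", OF ex] by (auto simp: p_def)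
  have min: "\<not> (0 < k \<and> tr x k = x)" if "k < p" for k
    using not_less_Least that unfolding p_def by blast
  have "tr x i \<noteq> tr x j" if "i < j" "j < p" for i j
  proof
    assume "tr x i = tr x j"
    then have "tr (tr x (j - i)) i = tr x i"
      using that by (metis add.commute le_add_diff_inverse less_imp_le travel_add)
    then have "tr x (j - i) = x" using travel_inj[OF travel_in[OF x] x] by blast
    moreover have "0 < j - i" "j - i < p" using that by arith+
    ultimately show False using min by blast
  qed
  then have inj: "inj_on (tr x) {..<p}"
    unfolding inj_on_def by (metis lessThan_iff linorder_neqE_nat)
  let ?P = "tr x ` {..<p}"
  have PC: "?P \<subseteq> C" using travel_in[OF x] by blast
  have step: "tr x (Suc i) \<in> ?P" if "i < p" for i
    using that p by (cases "Suc i = p") (auto intro!: image_eqI[of _ _ 0])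
  \<comment> \<open>From an entering corner, \<open>arc\<close> leads back to the corner where the
    preceding segment was left; at \<open>i = 0\<close> that is the last segment of the
    period.\<close>
  have retreat: "r (tr x i) \<in> s ` ?P" if ip: "i < p" for i
  proof -
    obtain j where j: "j < p" "tr x i = tr x (Suc j)"
    proof (cases i)
      case 0
      then show ?thesis using that[of "p - 1"] p by simp
    next
      case (Suc j)
      then show ?thesis using that[of j] ip by simp
    qed
    then have "r (tr x i) = s (tr x j)"
      using inv travel_in[OF x] by (simp add: travel_Suc)
    then show ?thesis using j by blast
  qed
  have "?P \<union> s ` ?P = C"
  proof (rule closed_eq_corners)
    show "?P \<union> s ` ?P \<subseteq> C" using PC inv by blast
    show "tr x 0 \<in> ?P \<union> s ` ?P" using p by blast
    show "s y \<in> ?P \<union> s ` ?P" if "y \<in> ?P \<union> s ` ?P" for y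
      using that inv PC by auto
    show "r y \<in> ?P \<union> s ` ?P" if y: "y \<in> ?P \<union> s ` ?P" for y
      using y
    proof
      assume "y \<in> ?P"
      then show ?thesis using retreat by blast
    next
      assume "y \<in> s ` ?P"
      then obtain i where "i < p" "y = s (tr x i)" by blast
      then show ?thesis using step[of i] by (simp add: travel_Suc)
    qed
  qed
  moreover have "?P \<inter> s ` ?P = {}"
  proof -
    have "tr x j \<noteq> s (tr x i)" if "i < p" "j < p" for i j
    proof -
      \<comment> \<open>A full period is added so that the difference of positions does not become
        negative.\<close>
      have "tr x j = tr x (p + j)" using p by (simp add: travel_add)
      also have "\<dots> = tr (tr x i) (p + j - i)"
        using that by (simp add: travel_add[symmetric])
      finally show ?thesis using seg_neq_travel[OF travel_in[OF x]] by metis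
    qed
    then show ?thesis by blast
  qed
  moreover have "card (s ` ?P) = card ?P"
    using PC inv(2) by (intro card_image inj_on_inverseI[of _ s]) auto
  ultimately have "card C = 2 * card ?P"
    by (metis card_Un_disjoint finite_Un fin mult_2)
  then have "N = p" using inj by (simp add: card_image)
  then show ?thesis using p inj \<open>?P \<union> s ` ?P = C\<close> by simp
qed

lemma travel_N: "x \<in> C \<Longrightarrow> tr x N = x"
  and inj_travel: "x \<in> C \<Longrightarrow> inj_on (tr x) {..<N}"
  and corners_eq: "x \<in> C \<Longrightarrow> C = tr x ` {..<N} \<union> s ` tr x ` {..<N}"
  using travel_structure by blast+

lemma N_pos: "0 < N"
  using travel_structure nonempty by blast

lemma travel_mult: "x \<in> C \<Longrightarrow> tr x (N * m) = x"
  by (induction m) (simp_all add: travel_add travel_N)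

lemma travel_back:
  assumes "x \<in> C"
  obtains k where "tr (tr x i) k = x"
proof -
  have "i \<le> N * i" using N_pos by simp
  then have "tr (tr x i) (N * i - i) = x"
    using travel_mult[OF assms, of i] by (simp add: travel_add[symmetric])
  then show ?thesis by (rule that)
qed

lemma seg_travel_neq: "x \<in> C \<Longrightarrow> s (tr x i) \<noteq> tr x j"
proof
  assume x: "x \<in> C" and eq: "s (tr x i) = tr x j"
  obtain k where "tr (tr x i) k = x" using travel_back[OF x] by blast
  then have "s (tr x i) = tr (tr x i) (k + j)" using eq by (simp add: travel_add)
  then show False using seg_neq_travel[OF travel_in[OF x]] by blast
qed

lemma travel_or_seg:
  assumes "x \<in> C" "z \<in> C"
  obtains i where "i < N" "tr x i = z \<or> tr x i = s z"
proof -
  consider "z \<in> tr x ` {..<N}" | "z \<in> s ` tr x ` {..<N}"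
    using corners_eq[OF assms(1)] assms(2) by blast
  then show ?thesis
  proof cases
    case 1
    then show ?thesis using that by blast
  next
    case 2
    then obtain i where "i < N" "z = s (tr x i)" by blast
    then show ?thesis using that[of i] inv(2)[OF travel_in[OF assms(1)]] by simp
  qed
qed

text \<open>Being entered in the same direction of travel: the corners form two classes, which
  \<open>seg\<close> exchanges.\<close>

definition coherent :: "'c \<Rightarrow> 'c \<Rightarrow> bool" where
  "coherent x y \<longleftrightarrow> (\<exists>i. y = tr x i)"

lemma coherent_sym: "x \<in> C \<Longrightarrow> coherent x y \<Longrightarrow> coherent y x"
  unfolding coherent_def by (metis travel_back)

lemma coherent_seg:
  assumes "x \<in> C" "y \<in> C"
  shows "coherent (s x) (s y) \<longleftrightarrow> coherent x y"
proof -
  have *: "coherent (s x) (s y)" if xy: "x \<in> C" "y \<in> C" "coherent x y" for x y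
  proof -
    obtain i where "y = tr x i" using xy(3) by (auto simp: coherent_def)
    then have "s x = tr (s y) i" using travel_seg[OF xy(1)] by simp
    then have "coherent (s y) (s x)" by (auto simp: coherent_def)
    then show ?thesis using coherent_sym inv xy by blast
  qed
  show ?thesis
    using *[OF assms] *[of "s x" "s y"] inv(1,2) assms by auto
qed

lemma coherent_seg_right:
  assumes "x \<in> C" "y \<in> C"
  shows "coherent x (s y) \<longleftrightarrow> \<not> coherent x y"
proof -
  obtain i where i: "tr x i = y \<or> tr x i = s y" using travel_or_seg[OF assms] by blast
  have "\<not> (coherent x y \<and> coherent x (s y))"
    using seg_travel_neq[OF assms(1)] by (auto simp: coherent_def)
  then show ?thesis using i unfolding coherent_def by metis
qed

text \<open>The walk meets the loop once more, in its other segment, entering at \<open>t x\<close>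
  if the loop is twisted and at \<open>s (t x)\<close> otherwise.\<close>

lemma opposite_end:
  assumes x: "x \<in> C"
  obtains q where "0 < q" "q < N" "tr x q = t x \<or> tr x q = s (t x)"
    "\<And>i. i < N \<Longrightarrow> edge_of (tr x i) = edge_of x \<longleftrightarrow> i = 0 \<or> i = q"
proof -
  have tx: "t x \<in> C" using inv x by blast
  obtain q where q: "q < N" "tr x q = t x \<or> tr x q = s (t x)"
    using travel_or_seg[OF x tx] by blast
  have ne: "x \<noteq> t x" "x \<noteq> s (t x)" using inv[OF x] inv(2)[OF tx] by metis+
  then have q0: "0 < q" using q by (cases q) auto
  have "edge_of (tr x i) = edge_of x \<longleftrightarrow> i = 0 \<or> i = q" if i: "i < N" for i
  proof
    assume "edge_of (tr x i) = edge_of x"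
    then have "tr x i \<in> {x, s x, t x, s (t x)}"
      using edge_of_in[of "tr x i"] by (simp add: edge_of_def)
    moreover have "tr x i \<noteq> s x" using seg_neq_travel[OF x] by metis
    moreover have "tr x q = t x \<Longrightarrow> tr x i \<noteq> s (t x)" "tr x q = s (t x) \<Longrightarrow> tr x i \<noteq> t x"
      using seg_travel_neq[OF x] inv(2)[OF tx] by metis+
    ultimately have "tr x i = tr x 0 \<or> tr x i = tr x q" using q by auto
    then show "i = 0 \<or> i = q"
      using inj_onD[OF inj_travel[OF x]] i q N_pos by auto
  next
    assume "i = 0 \<or> i = q"
    then show "edge_of (tr x i) = edge_of x"
      using q edge_of_seg[OF tx] edge_of_side[OF x] by auto
  qed
  then show ?thesis using that q q0 by blast
qed

lemma edge_positions:
  assumes "x \<in> C" "e \<in> edges B"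
  obtains a b where "a < b" "b < N" "{i. i < N \<and> edge_of (tr x i) = e} = {a, b}"
proof -
  obtain z where z: "z \<in> C" "e = edge_of z" using assms(2) edges_eq by auto
  obtain i where i: "i < N" "tr x i = z \<or> tr x i = s z"
    using travel_or_seg[OF assms(1) z(1)] by blast
  let ?w = "tr x i"
  have w: "?w \<in> C" "edge_of ?w = e" using travel_in[OF assms(1)] i z edge_of_seg by auto
  obtain q where q: "0 < q" "q < N"
    "\<And>j. j < N \<Longrightarrow> edge_of (tr ?w j) = edge_of ?w \<longleftrightarrow> j = 0 \<or> j = q"
    using opposite_end[OF w(1)] by metis
  \<comment> \<open>Position \<open>q\<close> counted from \<open>i\<close>, reduced modulo
    \<open>N\<close>.\<close>
  define j where "j = (if i + q < N then i + q else i + q - N)"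
  have j: "j < N" "j \<noteq> i" using q i by (auto simp: j_def)
  have shift: "tr ?w k = tr x (if i + k < N then i + k else i + k - N)" if "k < N" for k
  proof (cases "i + k < N")
    case False
    have "tr x (i + k) = tr x (N + (i + k - N))" using False by simp
    also have "\<dots> = tr x (i + k - N)" using travel_N[OF assms(1)] by (simp only: travel_add)
    finally show ?thesis using False by (simp add: travel_add[symmetric])
  qed (simp add: travel_add)
  have "edge_of (tr x k) = e \<longleftrightarrow> k = i \<or> k = j" if k: "k < N" for k
  proof -
    define m where "m = (if i \<le> k then k - i else k + N - i)"
    have m: "m < N" "(if i + m < N then i + m else i + m - N) = k"
      using k i by (auto simp: m_def)
    then have "edge_of (tr x k) = e \<longleftrightarrow> m = 0 \<or> m = q"
      using shift[of m] q(3)[of m] w by simp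
    also have "\<dots> \<longleftrightarrow> k = i \<or> k = j"
      using k i q(1,2) by (auto simp: m_def j_def)
    finally show ?thesis .
  qed
  then have "{k. k < N \<and> edge_of (tr x k) = e} = {i, j}" using i j by auto
  then show ?thesis
    using that[of i j] that[of j i] j i by (metis insert_commute linorder_neqE_nat)
qed

text \<open>Interlacement with a prescribed starting corner, so that positions of different loops
  can be compared on one walk.\<close>

definition crossing :: "'c \<Rightarrow> 'c set \<Rightarrow> bool" where
  "crossing x e \<longleftrightarrow> (\<exists>i j k. 0 < i \<and> i < j \<and> j < k \<and> k < N \<and>
     tr x i \<in> e \<and> edge_of (tr x j) = edge_of x \<and> tr x k \<in> e)"

text \<open>In reverse direction position \<open>l\<close> becomes \<open>N - l\<close>, which keeps
  an alternating pattern alternating.\<close>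

lemma crossing_seg:
  assumes "x \<in> C" "e \<in> edges B" "crossing x e"
  shows "crossing (s x) e"
proof -
  obtain i j k where ijk: "0 < i" "i < j" "j < k" "k < N"
    "tr x i \<in> e" "edge_of (tr x j) = edge_of x" "tr x k \<in> e"
    using assms(3) by (auto simp: crossing_def)
  have retreat: "tr (s x) (N - l) = s (tr x l)" if "l < N" for l
  proof -
    have "tr (s (tr x l)) (l + (N - l)) = s (tr x l)"
      using travel_N inv travel_in[OF assms(1)] that by simp
    then show ?thesis using travel_seg[OF assms(1)] by (simp add: travel_add)
  qed
  have seg: "s (tr x l) \<in> e \<longleftrightarrow> tr x l \<in> e" "edge_of (s (tr x l)) = edge_of (tr x l)" for l
    using in_edge_iff[OF assms(2)] edge_of_seg inv travel_in[OF assms(1)] by auto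
  show ?thesis
    unfolding crossing_def
    using ijk retreat seg edge_of_seg[OF assms(1)]
    by (intro exI[of _ "N - k"] exI[of _ "N - j"] exI[of _ "N - i"]) auto
qed

text \<open>The cyclic pattern of four ends is read from its third entry.\<close>

lemma crossing_opposite:
  assumes "x \<in> C" "e \<in> edges B" "crossing x e"
  obtains j where "0 < j" "j < N" "edge_of (tr x j) = edge_of x" "crossing (tr x j) e"
proof -
  obtain i j k where ijk: "0 < i" "i < j" "j < k" "k < N"
    "tr x i \<in> e" "edge_of (tr x j) = edge_of x" "tr x k \<in> e"
    using assms(3) by (auto simp: crossing_def)
  have "tr (tr x j) (N - j + l) = tr x l" for l
    using travel_add[of x N l] travel_N[OF assms(1)] ijk by (simp add: travel_add[symmetric])
  from this[of 0] this[of i] have "tr (tr x j) (N - j) = x" "tr (tr x j) (N - j + i) = tr x i"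
    by simp_all
  moreover have "tr (tr x j) (k - j) = tr x k" using ijk by (simp add: travel_add[symmetric])
  ultimately have "crossing (tr x j) e"
    unfolding crossing_def using ijk
    by (intro exI[of _ "k - j"] exI[of _ "N - j"] exI[of _ "N - j + i"]) auto
  then show ?thesis using that[of j] ijk by auto
qed

text \<open>Reversal and moving to the other end reach all four corners of the loop, so the
  existential start in \<open>interlaced\<close> may be any of them.\<close>

lemma interlaced_iff_crossing:
  assumes "x \<in> C" "e \<in> edges B"
  shows "interlaced B (edge_of x) e \<longleftrightarrow> crossing x e"
proof
  assume "crossing x e"
  then show "interlaced B (edge_of x) e"
    unfolding interlaced_def crossing_def
    using assms(1) edge_of_in edge_of_in[of "tr x _"] by metis
next
  assume "interlaced B (edge_of x) e"
  then obtain y i j k where y: "y \<in> C" "y \<in> edge_of x" and "0 < i" "i < j" "j < k" "k < N"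
    "tr y i \<in> e" "tr y j \<in> edge_of x" "tr y k \<in> e"
    unfolding interlaced_def by blast
  moreover from this have "edge_of (tr y j) = edge_of y"
    using edge_of_eq[OF assms(1)] by metis
  ultimately have cy: "crossing y e" unfolding crossing_def by blast
  have yx: "edge_of y = edge_of x" using edge_of_eq[OF assms(1) y(2)] .
  obtain l where l: "0 < l" "l < N" "edge_of (tr y l) = edge_of y" "crossing (tr y l) e"
    using crossing_opposite[OF y(1) assms(2) cy] by blast
  obtain q where q: "tr y q = t y \<or> tr y q = s (t y)"
    "\<And>i. i < N \<Longrightarrow> edge_of (tr y i) = edge_of y \<longleftrightarrow> i = 0 \<or> i = q"
    using opposite_end[OF y(1)] by metis
  have "l = q" using q(2)[of l] l by simp
  then have "crossing (t y) e \<or> crossing (s (t y)) e" using q(1) l(4) by auto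
  moreover have "t y \<in> C" "s (s (t y)) = t y" "s (t y) \<in> C" using inv y by auto
  ultimately have "crossing (t y) e" "crossing (s (t y)) e"
    using crossing_seg[OF _ assms(2)] by metis+
  moreover have "crossing (s y) e" using crossing_seg[OF y(1) assms(2) cy] .
  moreover have "x \<in> {y, s y, t y, s (t y)}" using yx edge_of_in[of x] by (simp add: edge_of_def)
  ultimately show "crossing x e" using cy by blast
qed

text \<open>The cyclic pattern is read from its second entry.\<close>

lemma interlaced_sym:
  assumes "e \<in> edges B" "e' \<in> edges B" "interlaced B e e'"
  shows "interlaced B e' e"
proof -
  obtain x where x: "x \<in> C" "e = edge_of x" using assms(1) edges_eq by auto
  then have "crossing x e'" using interlaced_iff_crossing assms by simp
  then obtain i j k where ijk: "0 < i" "i < j" "j < k" "k < N"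
    "tr x i \<in> e'" "edge_of (tr x j) = edge_of x" "tr x k \<in> e'"
    by (auto simp: crossing_def)
  let ?w = "tr x i"
  have w: "?w \<in> C" "e' = edge_of ?w"
    using travel_in[OF x(1)] in_edge_iff[OF assms(2)] ijk(5) by auto
  have "tr ?w (j - i) = tr x j" "tr ?w (k - i) = tr x k" "tr ?w (N - i) = x"
    using ijk travel_N[OF x(1)] by (simp_all add: travel_add[symmetric])
  moreover have "edge_of (tr x k) = edge_of ?w" using in_edge_iff[OF assms(2)] ijk(7) w by auto
  moreover have "tr x j \<in> e" using x ijk(6) edge_of_in[of "tr x j"] by simp
  moreover have "x \<in> e" using x edge_of_in by simp
  ultimately have "crossing ?w e"
    unfolding crossing_def using ijk
    by (intro exI[of _ "j - i"] exI[of _ "k - i"] exI[of _ "N - i"]) auto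
  then show ?thesis using interlaced_iff_crossing[OF w(1) assms(1)] w by simp
qed

lemma interlaced_irrefl:
  assumes "e \<in> edges B"
  shows "\<not> interlaced B e e"
proof
  assume il: "interlaced B e e"
  obtain x where x: "x \<in> C" "e = edge_of x" using assms edges_eq by auto
  then have "crossing x e" using interlaced_iff_crossing assms il by simp
  then obtain i j k where ijk: "0 < i" "i < j" "j < k" "k < N" "tr x i \<in> e" "tr x k \<in> e"
    by (auto simp: crossing_def)
  moreover obtain q where "\<And>i. i < N \<Longrightarrow> edge_of (tr x i) = edge_of x \<longleftrightarrow> i = 0 \<or> i = q"
    using opposite_end[OF x(1)] by metis
  ultimately have "i = q" "k = q" using in_edge_iff[OF assms] x by auto
  then show False using ijk by simp
qed

text \<open>A loop has two ends, so an odd number of them on the stretch between the ends of the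
  loop at \<open>x\<close> means exactly one, which is alternation.\<close>

lemma odd_between_iff_interlaced:
  assumes x: "x \<in> C" and q: "0 < q" "q < N" "edge_of (tr x q) = edge_of x" and e: "e \<in> edges B"
  shows "odd (card {i. 0 < i \<and> i < q \<and> edge_of (tr x i) = e}) \<longleftrightarrow> interlaced B (edge_of x) e"
proof -
  obtain a b where ab: "a < b" "b < N" "{i. i < N \<and> edge_of (tr x i) = e} = {a, b}"
    using edge_positions[OF x e] by blast
  have pos: "edge_of (tr x i) = e \<longleftrightarrow> i = a \<or> i = b" if "i < N" for i
    using ab(3) that by (auto simp: set_eq_iff)
  obtain q' where q': "\<And>i. i < N \<Longrightarrow> edge_of (tr x i) = edge_of x \<longleftrightarrow> i = 0 \<or> i = q'"
    using opposite_end[OF x] by metis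
  have qq: "q' = q" using q'[OF q(2)] q by auto
  show ?thesis
  proof (cases "e = edge_of x")
    case True
    have "{i. 0 < i \<and> i < q \<and> edge_of (tr x i) = e} = {}"
      using q' qq q True by auto
    then show ?thesis using True interlaced_irrefl[OF e] by (simp only: card.empty) simp
  next
    case False
    have "a \<noteq> 0" "a \<noteq> q" "b \<noteq> q"
      using pos[of 0] pos[of q] q False N_pos by auto
    have "{i. 0 < i \<and> i < q \<and> edge_of (tr x i) = e} = {i\<in>{a, b}. i < q}"
    proof (intro equalityI subsetI)
      fix i assume "i \<in> {i. 0 < i \<and> i < q \<and> edge_of (tr x i) = e}"
      then show "i \<in> {i\<in>{a, b}. i < q}" using pos[of i] q(2) by simp
    next
      fix i assume i: "i \<in> {i\<in>{a, b}. i < q}"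
      then have "0 < i" "i < N" using \<open>a \<noteq> 0\<close> ab(1) q(2) by auto
      then show "i \<in> {i. 0 < i \<and> i < q \<and> edge_of (tr x i) = e}" using pos[of i] i by simp
    qed
    also have "odd (card \<dots>) \<longleftrightarrow> a < q \<and> q < b"
    proof -
      consider "b < q" | "a < q" "q < b" | "q < a" using \<open>a \<noteq> q\<close> \<open>b \<noteq> q\<close> ab(1) by linarith
      then show ?thesis
      proof cases
        case 1
        then have "{i\<in>{a, b}. i < q} = {a, b}" using ab(1) by auto
        then show ?thesis using 1 ab(1) by simp
      next
        case 2
        then have "{i\<in>{a, b}. i < q} = {a}" by auto
        then show ?thesis using 2 by simp
      next
        case 3
        then have "{i\<in>{a, b}. i < q} = {}" using ab(1) by auto
        then show ?thesis using 3 by (simp only: card.empty) simp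
      qed
    qed
    also have "\<dots> \<longleftrightarrow> crossing x e"
    proof
      assume "a < q \<and> q < b"
      then show "crossing x e"
        unfolding crossing_def using pos[of a] pos[of b] ab(1,2) q \<open>a \<noteq> 0\<close>
        by (intro exI[of _ a] exI[of _ q] exI[of _ b]) (simp add: in_edge_iff[OF e] travel_in[OF x])
    next
      assume "crossing x e"
      then obtain i j k where ijk: "0 < i" "i < j" "j < k" "k < N"
        "tr x i \<in> e" "edge_of (tr x j) = edge_of x" "tr x k \<in> e"
        by (auto simp: crossing_def)
      then have "j = q" using q'[of j] qq by auto
      moreover have "i = a \<or> i = b" "k = a \<or> k = b"
        using pos[of i] pos[of k] ijk in_edge_iff[OF e] by auto
      ultimately show "a < q \<and> q < b" using ijk ab(1) by auto
    qed
    also have "\<dots> \<longleftrightarrow> interlaced B (edge_of x) e" using interlaced_iff_crossing[OF x e] by simp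
    finally show ?thesis .
  qed
qed

text \<open>Turns a row of the adjacency matrix over GF(2) into a count along the vertex boundary:
  loops that are not interlaced contribute 0 or 2.\<close>

lemma odd_between_iff_odd_interlaced:
  assumes x: "x \<in> C" and q: "0 < q" "q < N" "edge_of (tr x q) = edge_of x" and X: "X \<subseteq> edges B"
  shows "odd (card {i. 0 < i \<and> i < q \<and> edge_of (tr x i) \<in> X}) \<longleftrightarrow>
    odd (card {e\<in>X. interlaced B (edge_of x) e})"
proof -
  have finX: "finite X" using X fin edges_eq finite_subset by fastforce
  have "{i. 0 < i \<and> i < q \<and> edge_of (tr x i) \<in> X} =
      (\<Union>e\<in>X. {i. 0 < i \<and> i < q \<and> edge_of (tr x i) = e})" by auto
  also have "card \<dots> = (\<Sum>e\<in>X. card {i. 0 < i \<and> i < q \<and> edge_of (tr x i) = e})"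
  proof (rule card_UN_disjoint[OF finX]; intro ballI impI)
    show "finite {i. 0 < i \<and> i < q \<and> edge_of (tr x i) = e}" for e
      by (rule finite_subset[of _ "{..<q}"]) auto
  qed blast
  also have "odd \<dots> \<longleftrightarrow>
      odd (card {e\<in>X. odd (card {i. 0 < i \<and> i < q \<and> edge_of (tr x i) = e})})"
    by (simp only: even_sum_iff[OF finX])
  also have "{e\<in>X. odd (card {i. 0 < i \<and> i < q \<and> edge_of (tr x i) = e})} =
      {e\<in>X. interlaced B (edge_of x) e}"
    by (intro Collect_cong conj_cong refl odd_between_iff_interlaced[OF x q]) (use X in blast)
  finally show ?thesis .
qed

end

section \<open>Boundary components\<close>

text \<open>A general set of corners may be interlaced with itself; restriction to edges makes the
  relation irreflexive on the whole type.\<close>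

definition interlace_adj :: "'c ribbon \<Rightarrow> 'c set \<Rightarrow> 'c set \<Rightarrow> bool" where
  "interlace_adj B e e' \<longleftrightarrow> e \<in> edges B \<and> e' \<in> edges B \<and> interlaced B e e'"

text \<open>In an untwisted loop a free side joins a corner where travel enters to one where it
  leaves; joining two corners of the same direction marks a half-twist.\<close>

definition twisted :: "'c ribbon \<Rightarrow> 'c set set" where
  "twisted B = {e \<in> edges B. \<exists>x\<in>e. \<exists>i. side B x = travel B x i}"

context bouquet_with_edges
begin

lemma finite_edges: "finite (edges B)"
  using fin edges_eq by simp

lemma symp_interlace_adj: "symp (interlace_adj B)"
  using interlaced_sym by (auto simp: symp_def interlace_adj_def)

lemma irreflp_interlace_adj: "irreflp (interlace_adj B)"
  using interlaced_irrefl by (auto simp: irreflp_def interlace_adj_def)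

text \<open>Coherence is symmetric and survives applying \<open>seg\<close> to both corners, so all
  four corners of a loop give the same answer.\<close>

lemma edge_of_in_twisted_iff:
  assumes x: "x \<in> C"
  shows "edge_of x \<in> twisted B \<longleftrightarrow> coherent x (t x)"
proof -
  have e: "edge_of x \<in> edges B" using x edges_eq by blast
  have tx: "t x \<in> C" "t (t x) = x" "t (s x) = s (t x)" "s x \<in> C" using inv x by auto
  have 1: "coherent (s x) (t (s x)) \<longleftrightarrow> coherent x (t x)"
    using coherent_seg[OF x tx(1)] tx by simp
  have 2: "coherent (t x) (t (t x)) \<longleftrightarrow> coherent x (t x)"
    using coherent_sym[OF x] coherent_sym[OF tx(1)] tx(2) by metis
  have 3: "coherent (s (t x)) (t (s (t x))) \<longleftrightarrow> coherent (t x) (t (t x))"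
    using coherent_seg[OF tx(1) x] tx inv(10)[OF tx(1)] by simp
  have "edge_of x \<in> twisted B \<longleftrightarrow> (\<exists>y\<in>edge_of x. coherent y (t y))"
    using e by (simp add: twisted_def coherent_def)
  also have "\<dots> \<longleftrightarrow> coherent x (t x)"
    unfolding edge_of_def using 1 2 3 by blast
  finally show ?thesis .
qed

text \<open>
  A union \<open>T\<close> of boundary arcs of the vertex disc, together with the set \<open>X\<close> of edges whose
  segments separate \<open>T\<close> from its complement.
\<close>

definition jumps :: "'c set \<Rightarrow> 'c set set \<Rightarrow> bool" where
  "jumps T X \<longleftrightarrow> T \<subseteq> C \<and> (\<forall>x\<in>C. r x \<in> T \<longleftrightarrow> x \<in> T) \<and>
     (\<forall>x\<in>C. (s x \<in> T) \<noteq> (x \<in> T) \<longleftrightarrow> edge_of x \<in> X)"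

text \<open>A step of travel crosses one segment, where membership in \<open>T\<close> changes
  exactly at edges in \<open>X\<close>, and follows one arc, where it does not change.\<close>

lemma jumps_travel:
  assumes "jumps T X" "x \<in> C"
  shows "(tr x i \<in> T \<longleftrightarrow> x \<in> T) \<longleftrightarrow> even (card {j. j < i \<and> edge_of (tr x j) \<in> X})"
proof (induction i)
  case 0
  then show ?case by simp
next
  case (Suc i)
  let ?J = "{j. j < i \<and> edge_of (tr x j) \<in> X}"
  have y: "tr x i \<in> C" using travel_in assms(2) by blast
  have "tr x (Suc i) \<in> T \<longleftrightarrow> s (tr x i) \<in> T"
    using assms(1) inv(1)[OF y] by (auto simp: jumps_def travel_Suc)
  moreover have "(s (tr x i) \<in> T) \<noteq> (tr x i \<in> T) \<longleftrightarrow> edge_of (tr x i) \<in> X"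
    using assms(1) y by (auto simp: jumps_def)
  moreover have "{j. j < Suc i \<and> edge_of (tr x j) \<in> X} =
      (if edge_of (tr x i) \<in> X then insert i ?J else ?J)"
    by (auto simp: less_Suc_eq)
  ultimately show ?case using Suc.IH by auto
qed

lemma side_invariant_iff_kernel:
  assumes J: "jumps T X" and X: "X \<subseteq> edges B"
  shows "(\<forall>x\<in>C. t x \<in> T \<longleftrightarrow> x \<in> T) \<longleftrightarrow> X \<in> kernel (edges B) (interlace_adj B) (twisted B)"
proof -
  have "(t x \<in> T \<longleftrightarrow> x \<in> T) \<longleftrightarrow>
      (odd (card {e\<in>X. interlace_adj B (edge_of x) e}) \<longleftrightarrow> edge_of x \<in> X \<and> edge_of x \<in> twisted B)"
    if x: "x \<in> C" for x
  proof -
    have tx: "t x \<in> C" "s (s (t x)) = t x" using inv x by auto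
    obtain q where q: "0 < q" "q < N" "tr x q = t x \<or> tr x q = s (t x)"
      "edge_of (tr x q) = edge_of x"
      using opposite_end[OF x] by metis
    let ?J = "{j. 0 < j \<and> j < q \<and> edge_of (tr x j) \<in> X}"
    \<comment> \<open>Position 0 is the loop's own segment, crossed on leaving \<open>x\<close>; for
      a twisted loop it accounts for the diagonal term.\<close>
    have "{j. j < q \<and> edge_of (tr x j) \<in> X} = (if edge_of x \<in> X then insert 0 ?J else ?J)"
      using q(1) by (auto intro: gr0I)
    moreover have "finite ?J" by (rule finite_subset[of _ "{..<q}"]) auto
    ultimately have walk: "(tr x q \<in> T \<longleftrightarrow> x \<in> T) \<longleftrightarrow> (odd (card ?J) \<longleftrightarrow> edge_of x \<in> X)"
      unfolding jumps_travel[OF J x] by simp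
    have "edge_of x \<in> edges B" using x edges_eq by blast
    then have "{e\<in>X. interlace_adj B (edge_of x) e} = {e\<in>X. interlaced B (edge_of x) e}"
      using X by (auto simp: interlace_adj_def)
    then have odd: "odd (card ?J) \<longleftrightarrow> odd (card {e\<in>X. interlace_adj B (edge_of x) e})"
      using odd_between_iff_odd_interlaced[OF x q(1,2,4) X] by simp
    show ?thesis
    proof (cases "tr x q = t x")
      case True
      then have "coherent x (t x)" unfolding coherent_def by metis
      then have "edge_of x \<in> twisted B" using edge_of_in_twisted_iff[OF x] by simp
      then show ?thesis using True walk odd by auto
    next
      case False
      \<comment> \<open>Untwisted: the walk ends at \<open>s (t x)\<close>. Crossing the segment to
        \<open>t x\<close> changes the colour once more if the loop is in \<open>X\<close>, which
        cancels the change at position 0.\<close>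
      then have st: "tr x q = s (t x)" using q by blast
      then have "coherent x (s (t x))" unfolding coherent_def by metis
      then have "edge_of x \<notin> twisted B"
        using edge_of_in_twisted_iff[OF x] coherent_seg_right[OF x tx(1)] by simp
      moreover have "(s (t x) \<in> T) \<noteq> (t x \<in> T) \<longleftrightarrow> edge_of x \<in> X"
        using J tx(1) edge_of_side[OF x] by (auto simp: jumps_def)
      ultimately show ?thesis using st walk odd by auto
    qed
  qed
  then have "(\<forall>x\<in>C. t x \<in> T \<longleftrightarrow> x \<in> T) \<longleftrightarrow> (\<forall>e\<in>edges B.
      odd (card {e'\<in>X. interlace_adj B e e'}) \<longleftrightarrow> e \<in> X \<and> e \<in> twisted B)"
    unfolding edges_eq by blast
  then show ?thesis using X by (simp add: kernel_def)
qed

text \<open>Colours follow the parity of ends of edges in \<open>X\<close> met so far; this closes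
  up because every loop is met twice in one round.\<close>

lemma jumps_exists:
  assumes X: "X \<subseteq> edges B"
  shows "\<exists>T. jumps T X"
proof -
  obtain x where x: "x \<in> C" using nonempty by blast
  define c where "c i = card {j. j < i \<and> edge_of (tr x j) \<in> X}" for i
  have c_Suc: "c (Suc i) = c i + (if edge_of (tr x i) \<in> X then 1 else 0)" for i
  proof -
    have "{j. j < Suc i \<and> edge_of (tr x j) \<in> X} =
        (if edge_of (tr x i) \<in> X then insert i {j. j < i \<and> edge_of (tr x j) \<in> X}
         else {j. j < i \<and> edge_of (tr x j) \<in> X})"
      by (auto simp: less_Suc_eq)
    then show ?thesis by (simp add: c_def)
  qed
  have finX: "finite X" using X finite_edges finite_subset by blast
  have "c N = (\<Sum>e\<in>X. card {j. j < N \<and> edge_of (tr x j) = e})"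
  proof -
    have split: "{j. j < N \<and> edge_of (tr x j) \<in> X} = (\<Union>e\<in>X. {j. j < N \<and> edge_of (tr x j) = e})"
      by blast
    have "card (\<Union>e\<in>X. {j. j < N \<and> edge_of (tr x j) = e}) =
        (\<Sum>e\<in>X. card {j. j < N \<and> edge_of (tr x j) = e})"
    proof (rule card_UN_disjoint[OF finX]; intro ballI impI)
      show "finite {j. j < N \<and> edge_of (tr x j) = e}" for e
        by (rule finite_subset[of _ "{..<N}"]) auto
    qed blast
    then show ?thesis unfolding c_def split .
  qed
  also have "\<dots> = (\<Sum>e\<in>X. 2)"
  proof (rule sum.cong[OF refl])
    fix e assume "e \<in> X"
    then have "e \<in> edges B" using X by blast
    then obtain a b where ab: "a < b" "b < N" "{i. i < N \<and> edge_of (tr x i) = e} = {a, b}"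
      by (rule edge_positions[OF x])
    show "card {j. j < N \<and> edge_of (tr x j) = e} = 2"
      unfolding ab(3) using ab(1) by simp
  qed
  finally have cN: "even (c N)" by simp
  have c0: "c 0 = 0" by (simp add: c_def)
  \<comment> \<open>An entering corner takes the parity before its segment is crossed, a leaving
    corner the parity after it.\<close>
  define T where "T = {z. \<exists>i<N. z = tr x i \<and> even (c i)} \<union>
    {z. \<exists>i<N. z = s (tr x i) \<and> even (c (Suc i))}"
  have inj: "i = j" if "tr x i = tr x j" "i < N" "j < N" for i j
    using inj_onD[OF inj_travel[OF x]] that by simp
  have T1: "tr x i \<in> T \<longleftrightarrow> even (c i)" if i: "i < N" for i
  proof
    assume "tr x i \<in> T"
    then consider j where "j < N" "tr x i = tr x j" "even (c j)" | j where "tr x i = s (tr x j)"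
      unfolding T_def by fast
    then show "even (c i)"
      using inj i seg_travel_neq[OF x] by cases metis+
  qed (use i in \<open>auto simp: T_def\<close>)
  \<comment> \<open>The last step returns to the start, where the even \<open>c N\<close> agrees
    with \<open>c 0 = 0\<close>.\<close>
  have T1N: "tr x (Suc i) \<in> T \<longleftrightarrow> even (c (Suc i))" if "i < N" for i
  proof (cases "Suc i < N")
    case False
    then have "Suc i = N" using that by simp
    then show ?thesis using T1[of 0] N_pos c0 cN travel_N[OF x] by simp
  qed (rule T1)
  have T2: "s (tr x i) \<in> T \<longleftrightarrow> even (c (Suc i))" if i: "i < N" for i
  proof
    assume "s (tr x i) \<in> T"
    then consider j where "j < N" "s (tr x i) = s (tr x j)" "even (c (Suc j))"
      | j where "s (tr x i) = tr x j"
      unfolding T_def by fast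
    then show "even (c (Suc i))"
    proof cases
      case 1
      then have "tr x i = tr x j" using inv(2)[OF travel_in[OF x]] by metis
      then show ?thesis using inj i 1 by metis
    qed (use seg_travel_neq[OF x] in metis)
  qed (use i in \<open>auto simp: T_def\<close>)
  have all: "P z" if P: "\<And>i. i < N \<Longrightarrow> P (tr x i)" "\<And>i. i < N \<Longrightarrow> P (s (tr x i))" "z \<in> C" for P z
  proof -
    consider i where "i < N" "z = tr x i" | i where "i < N" "z = s (tr x i)"
      using corners_eq[OF x] P(3) by fast
    then show ?thesis using P(1,2) by cases simp_all
  qed
  have "T \<subseteq> C" using travel_in[OF x] inv(1)[OF travel_in[OF x]] unfolding T_def by fast
  moreover have "r z \<in> T \<longleftrightarrow> z \<in> T" if "z \<in> C" for z
    using that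
  proof (rule all[rotated 2])
    have *: "r (s (tr x i)) \<in> T \<longleftrightarrow> s (tr x i) \<in> T" if "i < N" for i
      using T1N[OF that] T2[OF that] by (simp add: travel_Suc)
    show "r (s (tr x i)) \<in> T \<longleftrightarrow> s (tr x i) \<in> T" if "i < N" for i by (rule *[OF that])
    show "r (tr x i) \<in> T \<longleftrightarrow> tr x i \<in> T" if i: "i < N" for i
    proof -
      obtain j where j: "j < N" "tr x i = tr x (Suc j)"
      proof (cases i)
        case 0
        then show ?thesis using that[of "N - 1"] N_pos travel_N[OF x] by simp
      next
        case (Suc j)
        then show ?thesis using that[of j] i by simp
      qed
      then have "r (tr x i) = s (tr x j)" "tr x i = r (s (tr x j))"
        using inv travel_in[OF x] by (simp_all add: travel_Suc)
      then show ?thesis using *[OF j(1)] by simp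
    qed
  qed
  moreover have "(s z \<in> T) \<noteq> (z \<in> T) \<longleftrightarrow> edge_of z \<in> X" if "z \<in> C" for z
    using that
  proof (rule all[rotated 2])
    show *: "(s (tr x i) \<in> T) \<noteq> (tr x i \<in> T) \<longleftrightarrow> edge_of (tr x i) \<in> X" if "i < N" for i
      using T1[OF that] T2[OF that] c_Suc[of i] by auto
    show "(s (s (tr x i)) \<in> T) \<noteq> (s (tr x i) \<in> T) \<longleftrightarrow> edge_of (s (tr x i)) \<in> X" if "i < N" for i
      using *[OF that] inv(2)[OF travel_in[OF x]] edge_of_seg[OF travel_in[OF x]] by auto
  qed
  ultimately show ?thesis unfolding jumps_def by blast
qed

text \<open>The corners on which both sets agree are closed under \<open>seg\<close> and
  \<open>arc\<close>.\<close>

lemma jumps_agree: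
  assumes "jumps T X" "jumps T' X" "x \<in> C" "x \<in> T \<longleftrightarrow> x \<in> T'"
  shows "T = T'"
proof -
  have "{y\<in>C. y \<in> T \<longleftrightarrow> y \<in> T'} = C"
  proof (rule closed_eq_corners)
    show "x \<in> {y\<in>C. y \<in> T \<longleftrightarrow> y \<in> T'}" using assms by blast
    show "s y \<in> {y\<in>C. y \<in> T \<longleftrightarrow> y \<in> T'}" "r y \<in> {y\<in>C. y \<in> T \<longleftrightarrow> y \<in> T'}"
      if "y \<in> {y\<in>C. y \<in> T \<longleftrightarrow> y \<in> T'}" for y
      using that assms(1,2) inv(1,7)[of y] by (auto simp: jumps_def)
  qed auto
  then show ?thesis using assms(1,2) unfolding jumps_def by blast
qed

lemma card_jumps:
  assumes "X \<subseteq> edges B"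
  shows "card {T. jumps T X} = 2"
proof -
  obtain T where T: "jumps T X" using jumps_exists[OF assms] by blast
  have T': "jumps (C - T) X" using T inv(1,7) unfolding jumps_def by blast
  obtain x where x: "x \<in> C" using nonempty by blast
  have "{T. jumps T X} = {T, C - T}"
    using jumps_agree[OF _ T x] jumps_agree[OF _ T' x] T T' x by blast
  moreover have "T \<noteq> C - T" using x by blast
  ultimately show ?thesis by simp
qed

text \<open>
  Colourings of the boundary components by two colours, counted by the edges at which the colour
  changes.  This replaces the theorem of Cohn, Lempel and Traldi on the corank of the intersection
  matrix.
\<close>

lemma two_power_num_boundary:
  "2 ^ num_boundary B = 2 * card (kernel (edges B) (interlace_adj B) (twisted B))"
proof -
  let ?K = "kernel (edges B) (interlace_adj B) (twisted B)"
  have "invariant_sets C {t, r} = (\<Union>X\<in>?K. {T. jumps T X})"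
  proof (intro equalityI subsetI)
    fix T assume T: "T \<in> invariant_sets C {t, r}"
    define X where "X = edge_of ` {x\<in>C. (s x \<in> T) \<noteq> (x \<in> T)}"
    have sub: "X \<subseteq> edges B" using edges_eq by (auto simp: X_def)
    have inT: "t x \<in> T \<longleftrightarrow> x \<in> T" "r x \<in> T \<longleftrightarrow> x \<in> T" if "x \<in> C" for x
      using T that by (auto simp: invariant_sets_def)
    \<comment> \<open>A colour change at one segment of an edge forces one at the other, since the
      free sides join corners of equal colour.\<close>
    have "(s x \<in> T) \<noteq> (x \<in> T)" if x: "x \<in> C" "edge_of x \<in> X" for x
    proof -
      obtain y where y: "y \<in> C" "edge_of x = edge_of y" "(s y \<in> T) \<noteq> (y \<in> T)"
        using x(2) by (auto simp: X_def)
      have "x \<in> {y, s y, t y, s (t y)}" using y(2) edge_of_in[of x] by (simp add: edge_of_def)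
      moreover have "s y \<in> C" "t y \<in> C" "s (s y) = y" "s (t y) = t (s y)" "s (s (t y)) = t y"
        using inv y(1) by auto
      ultimately show ?thesis using inT[OF y(1)] inT[of "s y"] y(3) by auto
    qed
    then have J: "jumps T X"
      using T inT unfolding jumps_def by (auto simp: invariant_sets_def X_def)
    then have "X \<in> ?K" using side_invariant_iff_kernel[OF J sub] inT by blast
    then show "T \<in> (\<Union>X\<in>?K. {T. jumps T X})" using J by blast
  next
    fix T assume "T \<in> (\<Union>X\<in>?K. {T. jumps T X})"
    then obtain X where X: "X \<in> ?K" "jumps T X" by blast
    then have "X \<subseteq> edges B" by (simp add: kernel_def)
    then have "\<forall>x\<in>C. t x \<in> T \<longleftrightarrow> x \<in> T" using side_invariant_iff_kernel X by blast
    then show "T \<in> invariant_sets C {t, r}"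
      using X(2) by (auto simp: invariant_sets_def jumps_def)
  qed
  moreover have "card (\<Union>X\<in>?K. {T. jumps T X}) = (\<Sum>X\<in>?K. card {T. jumps T X})"
  proof (rule card_UN_disjoint)
    show "finite ?K" by (rule finite_kernel[OF finite_edges])
    show "\<forall>X\<in>?K. finite {T. jumps T X}"
      using card_jumps by (auto simp: kernel_def intro: card_ge_0_finite)
    have "X = Y" if "X \<subseteq> edges B" "Y \<subseteq> edges B" "jumps T X" "jumps T Y" for X Y T
    proof -
      have "edge_of x \<in> X \<longleftrightarrow> edge_of x \<in> Y" if "x \<in> C" for x
        using \<open>jumps T X\<close> \<open>jumps T Y\<close> that unfolding jumps_def by blast
      then show ?thesis using that(1,2) edges_eq by auto
    qed
    then show "\<forall>X\<in>?K. \<forall>Y\<in>?K. X \<noteq> Y \<longrightarrow> {T. jumps T X} \<inter> {T. jumps T Y} = {}"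
      unfolding kernel_def by blast
  qed
  moreover have "(\<Sum>X\<in>?K. card {T. jumps T X}) = (\<Sum>X\<in>?K. 2)"
    by (rule sum.cong[OF refl card_jumps]) (simp add: kernel_def)
  ultimately show ?thesis
    using card_invariant_side_arc by simp
qed

end

section \<open>Binomial partial Petrial polynomials\<close>

context bouquet_with_edges
begin

lemma partial_petrial_bouquet_with_edges:
  assumes "A \<subseteq> edges B"
  shows "bouquet_with_edges (partial_petrial B A)"
proof
  show "bouquet (partial_petrial B A)"
    using bouquet ribbon_graph_partial_petrial[OF ribbon assms]
    by (simp add: bouquet_def num_vertices_def partial_petrial_def)
  show "corners (partial_petrial B A) \<noteq> {}"
    using nonempty by (simp add: partial_petrial_def)
qed

lemma travel_partial_petrial: "travel (partial_petrial B A) = travel B"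
  by (simp add: travel_def partial_petrial_def fun_eq_iff)

lemma edge_of_partial_petrial:
  assumes "A \<subseteq> edges B" "x \<in> C"
  shows "bouquet_with_edges.edge_of (partial_petrial B A) x = edge_of x"
proof -
  interpret P: bouquet_with_edges "partial_petrial B A"
    by (rule partial_petrial_bouquet_with_edges[OF assms(1)])
  show ?thesis
    unfolding P.edge_of_def edge_of_def
    using inv[OF assms(2)] inv(2)[OF inv(4)[OF assms(2)]] by (auto simp: partial_petrial_def)
qed

lemma edges_partial_petrial:
  assumes "A \<subseteq> edges B"
  shows "edges (partial_petrial B A) = edges B"
proof -
  interpret P: bouquet_with_edges "partial_petrial B A"
    by (rule partial_petrial_bouquet_with_edges[OF assms])
  have "P.edge_of x = edge_of x" if "x \<in> C" for x
    by (rule edge_of_partial_petrial[OF assms that])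
  then show ?thesis
    unfolding P.edges_eq edges_eq by (auto simp: partial_petrial_def)
qed

text \<open>Travel follows only \<open>seg\<close> and \<open>arc\<close>, which half-twists leave
  alone.\<close>

lemma interlace_adj_partial_petrial:
  assumes "A \<subseteq> edges B"
  shows "interlace_adj (partial_petrial B A) = interlace_adj B"
  unfolding interlace_adj_def interlaced_def edges_partial_petrial[OF assms] travel_partial_petrial
  by (simp add: partial_petrial_def)

text \<open>A half-twist replaces \<open>t x\<close> by \<open>s (t x)\<close>, and exactly one of
  these two is coherent with \<open>x\<close>.\<close>

lemma twisted_partial_petrial:
  assumes "A \<subseteq> edges B"
  shows "twisted (partial_petrial B A) = sym_diff (twisted B) A"
proof -
  interpret P: bouquet_with_edges "partial_petrial B A"
    by (rule partial_petrial_bouquet_with_edges[OF assms])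
  note edge = edge_of_partial_petrial[OF assms]
  have coh: "P.coherent = coherent"
    by (simp add: fun_eq_iff P.coherent_def coherent_def travel_partial_petrial)
  have "edge_of x \<in> twisted (partial_petrial B A) \<longleftrightarrow> edge_of x \<in> sym_diff (twisted B) A"
    if x: "x \<in> C" for x
  proof -
    have tx: "t x \<in> C" "t (s x) = s (t x)" using inv x by auto
    have x': "x \<in> corners (partial_petrial B A)" using x by (simp add: partial_petrial_def)
    have "x \<in> \<Union>A \<longleftrightarrow> edge_of x \<in> A"
    proof
      assume "x \<in> \<Union>A"
      then obtain e where "e \<in> A" "x \<in> e" by blast
      then show "edge_of x \<in> A" using in_edge_iff[of e x] assms by auto
    qed (use edge_of_in in blast)
    then have "side (partial_petrial B A) x = (if edge_of x \<in> A then s (t x) else t x)"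
      using tx by (simp add: partial_petrial_def)
    then have "edge_of x \<in> twisted (partial_petrial B A) \<longleftrightarrow>
        coherent x (if edge_of x \<in> A then s (t x) else t x)"
      using P.edge_of_in_twisted_iff[OF x'] unfolding edge[OF x] coh by (simp only:)
    then show ?thesis
      using coherent_seg_right[OF x tx(1)] edge_of_in_twisted_iff[OF x] by auto
  qed
  note iff = this
  have sub: "twisted (partial_petrial B A) \<subseteq> edge_of ` C" "sym_diff (twisted B) A \<subseteq> edge_of ` C"
    using edges_partial_petrial[OF assms] assms edges_eq by (auto simp: twisted_def)
  show ?thesis
  proof (rule set_eqI)
    show "e \<in> twisted (partial_petrial B A) \<longleftrightarrow> e \<in> sym_diff (twisted B) A" for e
    proof (cases "e \<in> edge_of ` C")
      case True
      then obtain x where "x \<in> C" "e = edge_of x" by blast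
      then show ?thesis using iff by simp
    next
      case False
      then show ?thesis using sub by blast
    qed
  qed
qed

text \<open>
  The substitution \<open>A = sym_diff (twisted B) D\<close> makes the sum run over the sets \<open>D\<close> of twisted
  loops.
\<close>

lemma two_power_num_boundary_petrial:
  assumes "D \<subseteq> edges B"
  shows "2 ^ num_boundary (partial_petrial B (sym_diff (twisted B) D)) =
    2 * card (kernel (edges B) (interlace_adj B) D)"
proof -
  let ?A = "sym_diff (twisted B) D"
  have A: "?A \<subseteq> edges B" using assms by (auto simp: twisted_def)
  interpret P: bouquet_with_edges "partial_petrial B ?A"
    by (rule partial_petrial_bouquet_with_edges[OF A])
  have "sym_diff (twisted B) ?A = D" by blast
  then show ?thesis
    using P.two_power_num_boundary
    unfolding edges_partial_petrial[OF A] interlace_adj_partial_petrial[OF A]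
      twisted_partial_petrial[OF A]
    by simp
qed

lemma euler_genus_petrial:
  assumes "A \<subseteq> edges B"
  shows "euler_genus (partial_petrial B A) =
    1 + int (card (edges B)) - int (num_boundary (partial_petrial B A))"
proof -
  interpret P: bouquet_with_edges "partial_petrial B A"
    by (rule partial_petrial_bouquet_with_edges[OF assms])
  show ?thesis using P.euler_genus_eq edges_partial_petrial[OF assms] by simp
qed

end

section \<open>Counting the terms of a sum of monomials\<close>

lemma coeff_sum_monom:
  assumes "finite I"
  shows "coeff (\<Sum>i\<in>I. monom (1::int) (F i)) k = int (card {i\<in>I. F i = k})"
proof -
  have "coeff (\<Sum>i\<in>I. monom (1::int) (F i)) k = (\<Sum>i\<in>I. if F i = k then 1 else 0)"
    by (simp add: coeff_sum)
  also have "\<dots> = (\<Sum>i\<in>{i\<in>I. F i = k}. 1)"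
    using assms by (simp add: sum.If_cases Int_def)
  finally show ?thesis by simp
qed

lemma binomial_poly_iff: "binomial_poly p \<longleftrightarrow> card {k. coeff p k \<noteq> 0} = 2"
proof
  assume "binomial_poly p"
  then obtain a b k m where "k \<noteq> m" "a \<noteq> 0" "b \<noteq> 0" "p = monom a k + monom b m"
    by (auto simp: binomial_poly_def)
  then have "{k. coeff p k \<noteq> 0} = {k, m}" by auto
  then show "card {k. coeff p k \<noteq> 0} = 2" using \<open>k \<noteq> m\<close> by simp
next
  assume "card {k. coeff p k \<noteq> 0} = 2"
  then obtain k m where km: "{k. coeff p k \<noteq> 0} = {k, m}" "k \<noteq> m"
    by (auto simp: card_2_iff)
  have "coeff p k \<noteq> 0" "coeff p m \<noteq> 0" using km(1) by blast+
  moreover have "p = monom (coeff p k) k + monom (coeff p m) m"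
  proof (rule poly_eqI)
    fix i
    have "coeff p i = 0" if "i \<noteq> k" "i \<noteq> m" using km(1) that by blast
    then show "coeff p i = coeff (monom (coeff p k) k + monom (coeff p m) m) i"
      using km(2) by auto
  qed
  ultimately show "binomial_poly p" using km(2) unfolding binomial_poly_def by blast
qed

text \<open>Coefficients count indices and cannot cancel, so the exponents that occur are the values
  of \<open>F\<close>.\<close>

lemma binomial_poly_sum_monom:
  assumes "finite I"
  shows "binomial_poly (\<Sum>i\<in>I. monom (1::int) (F i)) \<longleftrightarrow> card (F ` I) = 2"
proof -
  have "{k. coeff (\<Sum>i\<in>I. monom (1::int) (F i)) k \<noteq> 0} = F ` I"
    using assms by (auto simp: coeff_sum_monom)
  then show ?thesis by (simp add: binomial_poly_iff)
qed

lemma (in bouquet_with_edges) binomial_partial_petrial_poly: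
  "binomial_poly (partial_petrial_poly B) \<longleftrightarrow> path_like (edges B) (interlace_adj B)"
proof -
  let ?E = "edges B"
  let ?K = "\<lambda>D. card (kernel ?E (interlace_adj B) D)"
  define n where "n = card ?E"
  define f where "f D = num_boundary (partial_petrial B (sym_diff (twisted B) D))" for D
  \<comment> \<open>The Euler genus as exponent, in terms of the set \<open>D\<close> of loops that
    are twisted afterwards.\<close>
  define F where "F D = nat (1 + int n - int (f D))" for D
  note finE = finite_edges and sym = symp_interlace_adj and irr = irreflp_interlace_adj
  have E: "?E \<noteq> {}" using nonempty edges_eq by simp
  then have n: "n \<ge> 1" using finE by (simp add: n_def Suc_le_eq card_gt_0_iff)
  have f: "2 ^ f D = 2 * ?K D" if "D \<subseteq> ?E" for D
    using two_power_num_boundary_petrial[OF that] by (simp add: f_def)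
  have K_le: "?K D \<le> 2 ^ n" for D
  proof -
    have "?K D \<le> card (Pow ?E)"
      using finE by (intro card_mono) (auto simp: kernel_def)
    then show ?thesis using finE by (simp add: card_Pow n_def)
  qed
  \<comment> \<open>Since \<open>1 + n - f D\<close> is never negative, the truncation by
    \<open>nat\<close> merges no two exponents.\<close>
  have f_le: "f D \<le> Suc n" if "D \<subseteq> ?E" for D
  proof -
    have "(2::nat) ^ f D \<le> 2 ^ Suc n" using f[OF that] K_le[of D] by simp
    then show ?thesis by (rule power_le_imp_le_exp[rotated]) simp
  qed
  have tw: "twisted B \<subseteq> ?E" by (auto simp: twisted_def)
  have "(\<lambda>A. nat (euler_genus (partial_petrial B A))) ` Pow ?E = F ` Pow ?E"
  proof -
    have "Pow ?E = sym_diff (twisted B) ` Pow ?E"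
    proof (intro equalityI subsetI)
      fix A assume "A \<in> Pow ?E"
      show "A \<in> sym_diff (twisted B) ` Pow ?E"
      proof (rule image_eqI)
        show "A = sym_diff (twisted B) (sym_diff (twisted B) A)" by blast
        show "sym_diff (twisted B) A \<in> Pow ?E" using tw \<open>A \<in> Pow ?E\<close> by blast
      qed
    qed (use tw in blast)
    then have "(\<lambda>A. nat (euler_genus (partial_petrial B A))) ` Pow ?E =
        (\<lambda>A. nat (euler_genus (partial_petrial B A))) ` sym_diff (twisted B) ` Pow ?E"
      by (rule arg_cong)
    also have "\<dots> = (\<lambda>D. nat (euler_genus (partial_petrial B (sym_diff (twisted B) D)))) ` Pow ?E"
      by (simp only: image_image)
    also have "\<dots> = F ` Pow ?E"
    proof (rule image_cong[OF refl])
      fix D assume "D \<in> Pow ?E"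
      then have "sym_diff (twisted B) D \<subseteq> ?E" using tw by blast
      then show "nat (euler_genus (partial_petrial B (sym_diff (twisted B) D))) = F D"
        by (simp add: euler_genus_petrial F_def f_def n_def)
    qed
    finally show ?thesis .
  qed
  then have bin: "binomial_poly (partial_petrial_poly B) \<longleftrightarrow> card (F ` Pow ?E) = 2"
    using binomial_poly_sum_monom[of "Pow ?E"] finE by (simp add: partial_petrial_poly_def)
  \<comment> \<open>Halving the kernel removes exactly one boundary component, by comparing powers
    of 2.\<close>
  have halve: "\<exists>D'\<subseteq>?E. ?K D = 2 * ?K D' \<and> f D = Suc (f D')" if D: "D \<subseteq> ?E" "2 \<le> ?K D" for D
  proof -
    obtain D' where D': "D' \<subseteq> ?E" "?K D = 2 * ?K D'"
      using kernel_halve[OF finE sym D] by blast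
    then have "(2::nat) ^ f D = 2 ^ Suc (f D')" using f D(1) by simp
    then have "f D = Suc (f D')" by (subst (asm) power_inject_exp) simp_all
    then show ?thesis using D' by blast
  qed
  show ?thesis
  proof
    assume path: "path_like ?E (interlace_adj B)"
    obtain D where D: "D \<subseteq> ?E" "2 \<le> ?K D" using card_kernel_ge_2[OF finE E] by blast
    have le2: "?K D \<le> 2" for D using card_kernel_path_like[OF finE path] .
    have val: "f D = 1 \<or> f D = 2" if "D \<subseteq> ?E" for D
    proof -
      have "?K D > 0"
        using empty_in_kernel[of ?E "interlace_adj B" D] finite_kernel[OF finE]
        by (metis card_gt_0_iff empty_iff)
      then have "?K D = 1 \<or> ?K D = 2" using le2[of D] by linarith
      then have "(2::nat) ^ f D = 2 ^ 1 \<or> (2::nat) ^ f D = 2 ^ 2" using f[OF that] by auto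
      then show ?thesis by (simp only: power_inject_exp one_less_numeral_iff semiring_norm)
    qed
    obtain D' where D': "D' \<subseteq> ?E" "f D = Suc (f D')" using halve[OF D] by blast
    have "f D = 2" "f D' = 1" using val[OF D(1)] val[OF D'(1)] D'(2) by auto
    then have "F D = n - 1" "F D' = n" using n by (auto simp: F_def)
    moreover have "F D'' \<in> {n, n - 1}" if "D'' \<subseteq> ?E" for D''
      using val[OF that] n by (auto simp: F_def)
    ultimately have "F ` Pow ?E = {n, n - 1}"
      using imageI[of D "Pow ?E" F] imageI[of D' "Pow ?E" F] D(1) D'(1) by auto
    then show "binomial_poly (partial_petrial_poly B)" unfolding bin using n by auto
  next
    assume b: "binomial_poly (partial_petrial_poly B)"
    show "path_like ?E (interlace_adj B)"
    proof (rule ccontr)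
      assume "\<not> ?thesis"
      then obtain D where D: "D \<subseteq> ?E" "4 \<le> ?K D"
        using path_like_if_small_kernels[OF finE E sym irr] by (meson not_less)
      \<comment> \<open>A kernel with at least four elements can be halved twice, which gives three
        distinct exponents.\<close>
      obtain D1 where D1: "D1 \<subseteq> ?E" "?K D = 2 * ?K D1" "f D = Suc (f D1)"
        using halve[OF D(1)] D(2) by auto
      obtain D2 where D2: "D2 \<subseteq> ?E" "f D1 = Suc (f D2)"
        using halve[OF D1(1)] D1(2) D(2) by auto
      have "F D < F D1" "F D1 < F D2"
        using D1(3) D2(2) f_le[OF D(1)] by (auto simp: F_def)
      then have "card {F D, F D1, F D2} = 3" by simp
      moreover have "card {F D, F D1, F D2} \<le> card (F ` Pow ?E)"
        using D(1) D1(1) D2(1) finE by (intro card_mono) auto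
      ultimately show False using b bin by simp
    qed
  qed
qed

section \<open>From numberings to isomorphism with a path\<close>

lemma path_like_transfer:
  assumes "path_like W adj'" "bij_betw f V W" "\<And>x y. x \<in> V \<Longrightarrow> y \<in> V \<Longrightarrow> adj x y \<longleftrightarrow> adj' (f x) (f y)"
  shows "path_like V adj"
proof -
  obtain \<phi> where \<phi>: "bij_betw \<phi> W {..<card W}"
    "\<forall>x\<in>W. \<forall>y\<in>W. adj' x y \<longleftrightarrow> \<phi> x = Suc (\<phi> y) \<or> \<phi> y = Suc (\<phi> x)"
    using assms(1) by (auto simp: path_like_def)
  have "bij_betw (\<phi> \<circ> f) V {..<card V}"
    using bij_betw_trans[OF assms(2) \<phi>(1)] bij_betw_same_card[OF assms(2)] by simp
  moreover have "f x \<in> W" if "x \<in> V" for x using assms(2) that by (auto simp: bij_betw_def)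
  ultimately show ?thesis
    unfolding path_like_def using \<phi>(2) assms(3) by (intro exI[of _ "\<phi> \<circ> f"]) simp
qed

lemma pair_wf_digraph_path_graph: "pair_wf_digraph (path_graph n)"
  by unfold_locales (auto simp: path_graph_def)

lemma is_path_iff:
  "is_path G \<longleftrightarrow> (\<exists>n\<ge>1. \<exists>g. inj_on g {1..n} \<and> pverts G = g ` {1..n} \<and>
     parcs G = map_prod g g ` parcs (path_graph n))"
proof -
  have "pverts (path_graph n) = {1..n}" for n by (simp add: path_graph_def)
  then show ?thesis
    unfolding is_path_def graph_iso_iff[OF pair_wf_digraph_path_graph] by simp
qed

text \<open>The empty set is vacuously \<open>path_like\<close>, while a path has a vertex.
  Positions shift by one, as \<open>path_graph\<close> counts from 1.\<close>

lemma is_path_iff_path_like: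
  assumes "pair_graph G"
  shows "is_path G \<longleftrightarrow> pverts G \<noteq> {} \<and> path_like (pverts G) (\<lambda>x y. (x, y) \<in> parcs G)"
proof
  interpret pair_graph G by (fact assms)
  assume "is_path G"
  then obtain n g where n: "n \<ge> 1" and g: "inj_on g {1..n}" "pverts G = g ` {1..n}"
    and arcs: "parcs G = map_prod g g ` parcs (path_graph n)"
    unfolding is_path_iff by blast
  have arc: "(g i, g j) \<in> parcs G \<longleftrightarrow> j = i + 1 \<or> i = j + 1" if ij: "i \<in> {1..n}" "j \<in> {1..n}" for i j
  proof
    assume "(g i, g j) \<in> parcs G"
    then obtain i' j' where "g i = g i'" "g j = g j'" "(i', j') \<in> parcs (path_graph n)"
      using arcs by auto
    moreover from this have "i' \<in> {1..n}" "j' \<in> {1..n}" by (auto simp: path_graph_def)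
    ultimately show "j = i + 1 \<or> i = j + 1"
      using inj_onD[OF g(1)] ij by (auto simp: path_graph_def)
  next
    assume "j = i + 1 \<or> i = j + 1"
    then have "(i, j) \<in> parcs (path_graph n)" using ij by (simp add: path_graph_def)
    then show "(g i, g j) \<in> parcs G" unfolding arcs by (intro image_eqI[of _ _ "(i, j)"]) simp_all
  qed
  have "path_like {1..n} (\<lambda>i j. j = i + 1 \<or> i = j + 1)"
    by (rule path_likeI[of _ "\<lambda>i. i - 1"]) (auto simp: inj_on_def)
  moreover have bij: "bij_betw (inv_into {1..n} g) (pverts G) {1..n}"
    by (rule bij_betw_inv_into) (use g in \<open>simp add: bij_betw_def\<close>)
  ultimately have "path_like (pverts G) (\<lambda>x y. (x, y) \<in> parcs G)"
  proof (rule path_like_transfer)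
    fix x y assume "x \<in> pverts G" "y \<in> pverts G"
    then obtain i j where "i \<in> {1..n}" "j \<in> {1..n}" "x = g i" "y = g j" using g(2) by auto
    then show "(x, y) \<in> parcs G \<longleftrightarrow> inv_into {1..n} g y = inv_into {1..n} g x + 1
        \<or> inv_into {1..n} g x = inv_into {1..n} g y + 1"
      using arc inv_into_f_f[OF g(1)] by simp
  qed
  then show "pverts G \<noteq> {} \<and> path_like (pverts G) (\<lambda>x y. (x, y) \<in> parcs G)"
    using g(2) n by auto
next
  interpret pair_graph G by (fact assms)
  let ?V = "pverts G"
  assume "?V \<noteq> {} \<and> path_like ?V (\<lambda>x y. (x, y) \<in> parcs G)"
  then obtain \<phi> where V: "?V \<noteq> {}" and bij: "bij_betw \<phi> ?V {..<card ?V}"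
    and adj: "\<And>x y. x \<in> ?V \<Longrightarrow> y \<in> ?V \<Longrightarrow> (x, y) \<in> parcs G \<longleftrightarrow> \<phi> x = Suc (\<phi> y) \<or> \<phi> y = Suc (\<phi> x)"
    by (auto simp: path_like_def)
  define n where "n = card ?V"
  define g where "g i = inv_into ?V \<phi> (i - 1)" for i
  have n: "n \<ge> 1" using V finite_verts by (simp add: n_def Suc_le_eq card_gt_0_iff)
  have g\<phi>: "g (Suc (\<phi> x)) = x" if "x \<in> ?V" for x
    using bij that by (simp add: g_def bij_betw_def inv_into_f_f)
  have \<phi>g: "\<phi> (g i) = i - 1" "g i \<in> ?V" if "i \<in> {1..n}" for i
  proof -
    have "i - 1 \<in> \<phi> ` ?V" using bij that by (auto simp: bij_betw_def n_def)
    then show "\<phi> (g i) = i - 1" "g i \<in> ?V"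
      unfolding g_def by (rule f_inv_into_f, rule inv_into_into)
  qed
  have \<phi>n: "Suc (\<phi> x) \<in> {1..n}" if "x \<in> ?V" for x
    using bij_betwE[OF bij] that by (simp add: n_def Suc_le_eq)
  have "inj_on g {1..n}"
  proof (rule inj_onI)
    fix i j assume "i \<in> {1..n}" "j \<in> {1..n}" "g i = g j"
    then show "i = j" using \<phi>g(1)[of i] \<phi>g(1)[of j] by auto
  qed
  moreover have "?V = g ` {1..n}"
    using g\<phi> \<phi>g(2) \<phi>n by (metis (no_types, lifting) image_eqI image_subsetI subsetI subset_antisym)
  moreover have "parcs G = map_prod g g ` parcs (path_graph n)"
  proof (intro equalityI subsetI)
    fix a assume "a \<in> parcs G"
    then obtain x y where a: "a = (x, y)" "(x, y) \<in> parcs G" by (cases a) auto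
    then have xy: "x \<in> ?V" "y \<in> ?V" by (auto dest: in_arcsD1 in_arcsD2)
    then have "(Suc (\<phi> x), Suc (\<phi> y)) \<in> parcs (path_graph n)"
      using adj a(2) \<phi>n by (auto simp: path_graph_def)
    then show "a \<in> map_prod g g ` parcs (path_graph n)"
      using a(1) xy g\<phi> by (intro image_eqI[of _ _ "(Suc (\<phi> x), Suc (\<phi> y))"]) simp_all
  next
    fix a assume "a \<in> map_prod g g ` parcs (path_graph n)"
    then obtain i j where ij: "a = (g i, g j)" "i \<in> {1..n}" "j \<in> {1..n}" "j = i + 1 \<or> i = j + 1"
      by (auto simp: path_graph_def)
    then show "a \<in> parcs G" using adj[OF \<phi>g(2) \<phi>g(2)] \<phi>g(1) by auto
  qed
  ultimately show "is_path G"
    unfolding is_path_iff using n by blast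
qed

lemma pair_wf_digraph_intersection_graph: "pair_wf_digraph (intersection_graph B)"
  by unfold_locales (auto simp: intersection_graph_def)

theorem theorem6:
  fixes G :: "'a pair_pre_digraph"
  assumes "circle_graph G"
    and "Digraph_Component.connected (with_proj G)"
  shows "binomial_poly (circle_graph_poly G) \<longleftrightarrow> is_path G"
proof -
  define B where "B = (SOME B. represents B G)"
  have G: "pair_graph G" using assms(1) by (simp add: circle_graph_def)
  have "represents B G"
    using assms(1) someI_ex[of "\<lambda>B. represents B G"] by (simp add: circle_graph_def B_def)
  then have bouquet: "bouquet B" and iso: "graph_iso (intersection_graph B) G"
    by (simp_all add: represents_def)
  obtain f where f: "inj_on f (edges B)" "pverts G = f ` edges B"
    and arcs: "parcs G = map_prod f f ` parcs (intersection_graph B)"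
    using iso graph_iso_iff[OF pair_wf_digraph_intersection_graph, of B G]
    by (auto simp: intersection_graph_def)
  have poly: "circle_graph_poly G = partial_petrial_poly B"
    by (simp add: circle_graph_poly_def B_def)
  show ?thesis
  proof (cases "corners B = {}")
    \<comment> \<open>The bouquet is a bare vertex disc: \<open>G\<close> is empty and the
      polynomial a single monomial.\<close>
    case True
    then have E: "edges B = {}" by (simp add: edges_def orbits_def quotient_def)
    then have "\<not> binomial_poly (partial_petrial_poly B)"
      using binomial_poly_sum_monom[of "{{}}"] by (simp add: partial_petrial_poly_def)
    moreover have "\<not> is_path G"
      using is_path_iff_path_like[OF G] f(2) E by simp
    ultimately show ?thesis by (simp add: poly)
  next
    case False
    then interpret bouquet_with_edges B using bouquet by unfold_locales
    have bij: "bij_betw f (edges B) (pverts G)" using f by (simp add: bij_betw_def)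
    have adj: "interlace_adj B e e' \<longleftrightarrow> (f e, f e') \<in> parcs G"
      if e: "e \<in> edges B" "e' \<in> edges B" for e e'
    proof
      assume "interlace_adj B e e'"
      then have "(e, e') \<in> parcs (intersection_graph B)"
        by (simp add: interlace_adj_def intersection_graph_def)
      then show "(f e, f e') \<in> parcs G"
        unfolding arcs by (intro image_eqI[of _ _ "(e, e')"]) simp_all
    next
      assume "(f e, f e') \<in> parcs G"
      then obtain d d' where d: "f e = f d" "f e' = f d'" "(d, d') \<in> parcs (intersection_graph B)"
        using arcs by auto
      then have "interlace_adj B d d'" by (simp add: interlace_adj_def intersection_graph_def)
      moreover from this have "e = d" "e' = d'"
        using inj_onD[OF f(1)] d(1,2) e by (auto simp: interlace_adj_def)
      ultimately show "interlace_adj B e e'" by simp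
    qed
    have "path_like (edges B) (interlace_adj B) \<longleftrightarrow> path_like (pverts G) (\<lambda>x y. (x, y) \<in> parcs G)"
    proof
      assume "path_like (pverts G) (\<lambda>x y. (x, y) \<in> parcs G)"
      then show "path_like (edges B) (interlace_adj B)"
        by (rule path_like_transfer[OF _ bij]) (rule adj)
    next
      assume "path_like (edges B) (interlace_adj B)"
      then show "path_like (pverts G) (\<lambda>x y. (x, y) \<in> parcs G)"
      proof (rule path_like_transfer[OF _ bij_betw_inv_into[OF bij]])
        fix x y assume "x \<in> pverts G" "y \<in> pverts G"
        then show "(x, y) \<in> parcs G \<longleftrightarrow>
            interlace_adj B (inv_into (edges B) f x) (inv_into (edges B) f y)"
          using adj[OF inv_into_into inv_into_into, of x f y] f(2) by (simp add: f_inv_into_f)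
      qed
    qed
    moreover have "pverts G \<noteq> {}" using f(2) nonempty edges_eq by simp
    ultimately show ?thesis
      using binomial_partial_petrial_poly is_path_iff_path_like[OF G] by (simp add: poly)
  qed
qed

end
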